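(* Let $L/K$ be a nontrivial finite extension inside $\bar K$, and let $G={\rm Gal}(\tilde L/K)$, $H={\rm Gal}(\tilde L/L)$. (1) The field $N=\tilde L^{N_G(H)}$ is the unique intermediate field $K\subseteq N\subseteq L$ such that $L/N$ is Galois of degree $[L:N]=r_K(L)$. Hence $[N:K]=s_K(L)$. (2) There is a unique strictly descending chain of subfields $L=N_0\supsetneq N_1\supsetneq\cdots\supsetneq N_k$ such that for all $i\ge1$, $N_{i-1}/N_i$ is Galois of degree $[N_{i-1}:N_i]=r_K(N_{i-1})$, the chain terminating at $N_k$ with $r_K(N_k)=1$. Hence $[N_i:K]=s_K(N_{i-1})$ for all $i\ge1$, and $s_K(N_{k-1})=s_K(N_k)$. This chain corresponds (via $N_i=\tilde L^{H_i}$) to the unique strictly ascending chain of subgroups $H=H_0\subsetneq H_1\subsetneq\cdots\subsetneq H_k$ of $G$ with $H_i=N_G(H_{i-1})$ (so each $H_{i-1}$ is a proper normal subgroup of $H_i$) and $N_G(H_k)=H_k$; moreover $r_K(N_i)=[H_{i+1}:H_i]$ and $s_K(N_i)=[G:H_{i+1}]$. (3) $L/K$ is obtained by weak cluster magnification from $N_k/K$ with magnification factor $r_K(L)$. (4) $N_k=K$ if and only if $N_{k-1}/K$ is Galois. (5) $r_K(L)=1$ iff $N_G(H)=H$ iff the chain in (2) is the singleton $L$. (6) $L/K$ is Galois iff $N_G(H)=G$ iff the chain in (2) is $L\supsetneq K$. (7) $N_G(H)$ is a proper normal subgroup of $G$ iff the chain in (2) is $L\supsetneq N\supsetneq K$.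
   Context: $K$ is a perfect field with a fixed algebraic closure $\bar K$; all extensions are finite and contained in $\bar K$. For a finite extension $L/K$, $\tilde L$ denotes its Galois closure in $\bar K$. Writing $L=K(\alpha)$ with $f$ the minimal polynomial of $\alpha$ over $K$, the cluster size $r_K(L)$ is the number of roots of $f$ lying in $L$ (independent of $\alpha$; it equals $|{\rm Aut}(L/K)|$), and $s_K(L)=[L:K]/r_K(L)$. For $K\subseteq L\subseteq M$, $M/K$ is said to be obtained by weak cluster magnification from $L/K$ if $r_K(L)\mid r_K(M)$; the magnification factor is $r_K(M)/r_K(L)$. $N_G(H)$ denotes the normalizer of $H$ in $G$. *)

theory Defs
  imports "HOL-Algebra.Algebraic_Closure" "HOL-Algebra.Group_Action" "HOL-Algebra.Generated_Fields" "HOL-Computational_Algebra.Primes"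
begin

text \<open>Throughout, the ring record R plays the role of the fixed algebraic closure of K;
  all fields considered are subfields (subsets of carrier R).\<close>

definition perfect_subfield :: "'a ring \<Rightarrow> 'a set \<Rightarrow> bool" where
  "perfect_subfield R K \<longleftrightarrow>
     (\<forall>n::nat. n > 0 \<longrightarrow> add_pow R n \<one>\<^bsub>R\<^esub> \<noteq> \<zero>\<^bsub>R\<^esub>) \<or>
     (\<exists>p::nat. Factorial_Ring.prime p \<and> add_pow R p \<one>\<^bsub>R\<^esub> = \<zero>\<^bsub>R\<^esub> \<and>
        (\<forall>x\<in>K. \<exists>y\<in>K. y [^]\<^bsub>R\<^esub> p = x))"

definition ext_degree :: "'a ring \<Rightarrow> 'a set \<Rightarrow> 'a set \<Rightarrow> nat" where
  "ext_degree R F M = ring.dim R F M"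

definition finite_ext :: "'a ring \<Rightarrow> 'a set \<Rightarrow> 'a set \<Rightarrow> bool" where
  "finite_ext R F M \<longleftrightarrow> subfield F R \<and> subfield M R \<and> F \<subseteq> M \<and> ring.finite_dimension R F M"

definition normal_ext :: "'a ring \<Rightarrow> 'a set \<Rightarrow> 'a set \<Rightarrow> bool" where
  "normal_ext R F M \<longleftrightarrow>
     (\<forall>x\<in>M. \<forall>y\<in>carrier R. ring.eval R (ring.Irr R F x) y = \<zero>\<^bsub>R\<^esub> \<longrightarrow> y \<in> M)"

definition separable_ext :: "'a ring \<Rightarrow> 'a set \<Rightarrow> 'a set \<Rightarrow> bool" where
  "separable_ext R F M \<longleftrightarrow> (\<forall>x\<in>M. \<forall>y. ring.alg_mult R (ring.Irr R F x) y \<le> 1)"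

definition galois_ext :: "'a ring \<Rightarrow> 'a set \<Rightarrow> 'a set \<Rightarrow> bool" where
  "galois_ext R F M \<longleftrightarrow> finite_ext R F M \<and> normal_ext R F M \<and> separable_ext R F M"

definition galois_closure :: "'a ring \<Rightarrow> 'a set \<Rightarrow> 'a set \<Rightarrow> 'a set" where
  "galois_closure R F M = \<Inter> {E. M \<subseteq> E \<and> galois_ext R F E}"

definition Aut :: "'a ring \<Rightarrow> 'a set \<Rightarrow> 'a set \<Rightarrow> ('a \<Rightarrow> 'a) set" where
  "Aut R F M = {\<sigma>. \<sigma> \<in> ring_iso (R\<lparr>carrier := M\<rparr>) (R\<lparr>carrier := M\<rparr>) \<and>
                    \<sigma> \<in> extensional M \<and> (\<forall>x\<in>F. \<sigma> x = x)}"

definition Gal :: "'a ring \<Rightarrow> 'a set \<Rightarrow> 'a set \<Rightarrow> ('a \<Rightarrow> 'a) monoid" where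
  "Gal R F M = \<lparr>carrier = Aut R F M, monoid.mult = (\<lambda>\<sigma> \<tau>. restrict (\<sigma> \<circ> \<tau>) M),
                one = restrict id M\<rparr>"

definition fixed_field :: "'a set \<Rightarrow> ('a \<Rightarrow> 'a) set \<Rightarrow> 'a set" where
  "fixed_field M S = {x\<in>M. \<forall>\<sigma>\<in>S. \<sigma> x = x}"

definition cluster_size :: "'a ring \<Rightarrow> 'a set \<Rightarrow> 'a set \<Rightarrow> nat" where
  "cluster_size R F M =
     (let \<alpha> = (SOME \<alpha>. \<alpha> \<in> M \<and> generate_field R (insert \<alpha> F) = M)
      in card {y\<in>M. ring.eval R (ring.Irr R F \<alpha>) y = \<zero>\<^bsub>R\<^esub>})"

definition cluster_s :: "'a ring \<Rightarrow> 'a set \<Rightarrow> 'a set \<Rightarrow> nat" where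
  "cluster_s R F M = ext_degree R F M div cluster_size R F M"

definition weak_cluster_magnification :: "'a ring \<Rightarrow> 'a set \<Rightarrow> 'a set \<Rightarrow> 'a set \<Rightarrow> bool" where
  "weak_cluster_magnification R F L M \<longleftrightarrow>
     F \<subseteq> L \<and> L \<subseteq> M \<and> cluster_size R F L dvd cluster_size R F M"

definition magnification_factor :: "'a ring \<Rightarrow> 'a set \<Rightarrow> 'a set \<Rightarrow> 'a set \<Rightarrow> nat" where
  "magnification_factor R F L M = cluster_size R F M div cluster_size R F L"

definition field_chain :: "'a ring \<Rightarrow> 'a set \<Rightarrow> 'a set \<Rightarrow> 'a set list \<Rightarrow> bool" where
  "field_chain R K L Ns \<longleftrightarrow>
     Ns \<noteq> [] \<and> Ns ! 0 = L \<and>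
     (\<forall>i < length Ns. subfield (Ns ! i) R \<and> K \<subseteq> Ns ! i) \<and>
     (\<forall>i. 1 \<le> i \<and> i < length Ns \<longrightarrow>
        Ns ! i \<subset> Ns ! (i - 1) \<and> galois_ext R (Ns ! i) (Ns ! (i - 1)) \<and>
        ext_degree R (Ns ! i) (Ns ! (i - 1)) = cluster_size R K (Ns ! (i - 1))) \<and>
     cluster_size R K (last Ns) = 1"

definition group_chain :: "('b, 'c) monoid_scheme \<Rightarrow> 'b set \<Rightarrow> 'b set list \<Rightarrow> bool" where
  "group_chain G H Hs \<longleftrightarrow>
     Hs \<noteq> [] \<and> Hs ! 0 = H \<and>
     (\<forall>i < length Hs. subgroup (Hs ! i) G) \<and>
     (\<forall>i. 1 \<le> i \<and> i < length Hs \<longrightarrow>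
        Hs ! (i - 1) \<subset> Hs ! i \<and> Hs ! i = normalizer G (Hs ! (i - 1))) \<and>
     normalizer G (last Hs) = last Hs"

end

theory Submission
  imports Defs "HOL-Algebra.Zassenhaus"
begin

text \<open>By the Galois correspondence inside the Galois closure \<open>E\<close>, an intermediate field \<open>F\<close> is
  encoded by \<open>Aut R F E\<close>. An automorphism normalises this subgroup iff it maps \<open>F\<close> into
  itself, and the normalizer acts on a primitive element \<open>\<alpha>\<close> of \<open>F\<close> with stabilizer
  \<open>Aut R F E\<close> and with orbit the conjugates of \<open>\<alpha>\<close> lying in \<open>F\<close>. Hence the cluster
  size is the index of the subgroup in its normalizer, and the fixed field of the normalizer is the only
  subfield of that codegree over which \<open>F\<close> is Galois: any such subfield has its Galois group inside the
  normalizer. Iterating this step yields both chains at once.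

  The transitivity of the automorphism group on conjugates needs no extension theorem for embeddings.
  If \<open>E\<close> contains all conjugates of its primitive element, then every group \<open>Aut R F E\<close> has
  \<open>[E : F]\<close> elements, and orbit counting forces the orbit of \<open>x\<close> to have as many elements
  as \<open>x\<close> has conjugates over \<open>F\<close>.\<close>

text \<open>Everything rests on one numerical fact: an element has as many conjugates as its minimal
  polynomial has degree. Perfectness of \<open>K\<close> enters here, and only minimal polynomials
  over \<open>K\<close> itself need the derivative argument; over a larger field the minimal
  polynomial divides the one over \<open>K\<close>. The Galois closure is given as an intersection
  of Galois extensions. The argument sees it only through a primitive element
  \<open>\<theta>\<close> whose conjugates all lie in it; normality of the other elements follows
  from transitivity. Both halves of the correspondence are used. Recovering a field from its group
  gives uniqueness of \<open>N\<close>. Recovering a group from its fixed field (Artin) shows that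
  the Galois group over \<open>N\<close> is the normalizer and nothing larger, so that taking fixed
  fields of normalizers can be repeated in step with taking normalizers. The group chain is defined
  by a rule for its next term, but the field chain by a degree condition. Uniqueness of
  \<open>N\<close> turns that condition into a rule as well, and then uniqueness of both chains is a
  fact about iterating a function until it becomes stationary.\<close>

section \<open>Separability over perfect fields\<close>

context cring
begin

lemma binomial_expansion:
  assumes "x \<in> carrier R" "y \<in> carrier R"
  shows "(x \<oplus> y) [^] (n::nat) = (\<Oplus>k\<in>{..n}. [(n choose k)] \<cdot> (x [^] k \<otimes> y [^] (n - k)))"
proof (induct n)
  case 0 then show ?case using assms by simp
next
  case (Suc n)
  define f where "f k = [(n choose k)] \<cdot> (x [^] k \<otimes> y [^] (n - k))" for k
  define g where "g k = [(n choose k)] \<cdot> (x [^] k \<otimes> y [^] (Suc n - k))" for k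
  define h where "h k = [(Suc n choose k)] \<cdot> (x [^] k \<otimes> y [^] (Suc n - k))" for k
  have fc: "f \<in> {..m} \<rightarrow> carrier R" and gc: "g \<in> {..m} \<rightarrow> carrier R" and hc: "h \<in> {..m} \<rightarrow> carrier R" for m
    unfolding f_def g_def h_def using assms by auto
  have *: "f k \<otimes> x \<in> carrier R" "f k \<otimes> y \<in> carrier R" "g k \<in> carrier R" for k
    unfolding f_def g_def using assms by auto
  \<comment> \<open>Pascal's rule: the first summand comes from multiplying the expansion for
    \<open>n\<close> by \<open>x\<close>, the second from multiplying it by
    \<open>y\<close>.\<close>
  have hS: "h (Suc i) = f i \<otimes> x \<oplus> g (Suc i)" for i
  proof -
    have "[(n choose i)] \<cdot> (x [^] Suc i \<otimes> y [^] (n - i)) = f i \<otimes> x"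
      unfolding f_def using assms by (simp add: add_pow_ldistr add_pow_rdistr m_ac)
    then show ?thesis
      unfolding h_def g_def using assms by (simp add: add.nat_pow_mult[symmetric])
  qed
  have h0: "h 0 = g 0" unfolding h_def g_def using assms by simp
  have gfy: "g k = f k \<otimes> y" if "k \<in> {..n}" for k
    using that assms unfolding g_def f_def by (simp add: add_pow_ldistr add_pow_rdistr m_ac Suc_diff_le)
  have gl: "g (Suc n) = \<zero>" unfolding g_def using assms by (simp add: binomial_eq_0)
  have "finsum R h {..Suc n} = (\<Oplus>i\<in>{..n}. h (Suc i)) \<oplus> h 0"
    by (rule finsum_Suc2[OF hc])
  also have "(\<Oplus>i\<in>{..n}. h (Suc i)) = (\<Oplus>i\<in>{..n}. f i \<otimes> x) \<oplus> (\<Oplus>i\<in>{..n}. g (Suc i))"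
    unfolding hS using * by (intro finsum_addf) auto
  also have "\<dots> \<oplus> h 0 = (\<Oplus>i\<in>{..n}. f i \<otimes> x) \<oplus> finsum R g {..Suc n}"
    unfolding finsum_Suc2[OF gc] h0 using * by (simp add: a_assoc)
  also have "finsum R g {..Suc n} = (\<Oplus>i\<in>{..n}. f i \<otimes> y)"
    unfolding finsum_Suc[OF gc] gl using *
    by (auto simp: gfy intro!: finsum_cong')
  also have "(\<Oplus>i\<in>{..n}. f i \<otimes> x) = finsum R f {..n} \<otimes> x"
    using fc assms by (simp add: finsum_ldistr Pi_iff)
  also have "(\<Oplus>i\<in>{..n}. f i \<otimes> y) = finsum R f {..n} \<otimes> y"
    using fc assms by (simp add: finsum_ldistr Pi_iff)
  also have "finsum R f {..n} \<otimes> x \<oplus> finsum R f {..n} \<otimes> y = (x \<oplus> y) [^] Suc n"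
    unfolding nat_pow_Suc Suc f_def[symmetric] using fc assms by (simp add: r_distr)
  finally show ?case unfolding h_def by simp
qed

lemma add_pow_dvd_zero:
  assumes "[(p::nat)] \<cdot> \<one> = \<zero>" "p dvd n" "x \<in> carrier R"
  shows "[n] \<cdot> x = \<zero>"
proof -
  obtain k where n: "n = p * k" using assms(2) by blast
  have "[p] \<cdot> x = [p] \<cdot> \<one> \<otimes> x" using assms(3) by (simp add: add_pow_ldistr)
  then have "[p] \<cdot> x = \<zero>" using assms by simp
  then show ?thesis unfolding n using assms(3) by (simp flip: add.nat_pow_pow)
qed

text \<open>The prime \<open>p\<close> divides every binomial coefficient except the two outer ones,
  so only the end terms of the expansion survive. Writing \<open>p\<close> as
  \<open>Suc (Suc m)\<close> allows one term to be peeled off at each end.\<close>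

lemma frobenius_add:
  assumes p: "Factorial_Ring.prime (p::nat)" and char: "[p] \<cdot> \<one> = \<zero>"
    and x: "x \<in> carrier R" and y: "y \<in> carrier R"
  shows "(x \<oplus> y) [^] p = x [^] p \<oplus> y [^] p"
proof -
  obtain m where m: "p = Suc (Suc m)"
    using prime_ge_2_nat[OF p] by (metis add_2_eq_Suc le_Suc_ex)
  define f where "f k = [(p choose k)] \<cdot> (x [^] k \<otimes> y [^] (p - k))" for k
  have fc: "f k \<in> carrier R" for k unfolding f_def using x y by auto
  have fz: "f (Suc i) = \<zero>" if "i \<in> {..m}" for i
    unfolding f_def
  proof (rule add_pow_dvd_zero[OF char])
    show "p dvd (p choose Suc i)" by (rule dvd_choose_prime) (use that m p in auto)
  qed (use x y in auto)
  have "(x \<oplus> y) [^] p = finsum R f {..Suc (Suc m)}"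
    unfolding binomial_expansion[OF x y] f_def m ..
  also have "\<dots> = (\<Oplus>i\<in>{..Suc m}. f (Suc i)) \<oplus> f 0"
    by (rule finsum_Suc2) (use fc in auto)
  also have "(\<Oplus>i\<in>{..Suc m}. f (Suc i)) = f (Suc (Suc m)) \<oplus> (\<Oplus>i\<in>{..m}. f (Suc i))"
    by (rule finsum_Suc) (use fc in auto)
  also have "(\<Oplus>i\<in>{..m}. f (Suc i)) = (\<Oplus>i\<in>{..m}. \<zero>)"
    by (rule finsum_cong') (use fz in auto)
  also have "\<dots> = \<zero>" by simp
  finally show ?thesis unfolding f_def m using x y by simp
qed

end

section \<open>Formal derivatives of coefficient lists\<close>

context ring
begin

text \<open>The formal derivative. Lists carry the leading coefficient first, so the exponent of the
  head is the length of the tail. The result is not normalized: in prime characteristic it may begin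
  with zeros, or consist of zeros only.\<close>

fun pderiv :: "'a list \<Rightarrow> 'a list" where
  "pderiv [] = []"
| "pderiv [a] = []"
| "pderiv (a # b # p) = [(length (b # p))] \<cdot> a # pderiv (b # p)"

lemma length_pderiv: "length (pderiv p) = length p - 1"
  by (induct p rule: pderiv.induct) auto

lemma pderiv_in_carrier: "set p \<subseteq> carrier R \<Longrightarrow> set (pderiv p) \<subseteq> carrier R"
  by (induct p rule: pderiv.induct) auto

lemma coeff_pderiv:
  "set p \<subseteq> carrier R \<Longrightarrow> coeff (pderiv p) i = [Suc i] \<cdot> coeff p (Suc i)"
proof (induct p rule: pderiv.induct)
  case (3 a b p)
  show ?case
    using 3 by (auto simp: length_pderiv)
qed auto

text \<open>Two such lists can differ only by leading zeros, which \<open>normalize\<close> removes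
  and \<open>eval\<close> ignores.\<close>

lemma eval_eq_if_coeff_eq:
  assumes "set p \<subseteq> carrier R" "set q \<subseteq> carrier R" "coeff p = coeff q" "x \<in> carrier R"
  shows "eval p x = eval q x"
proof -
  have "normalize p = normalize q"
    using assms coeff_iff_polynomial_cond[OF normalize_gives_polynomial[OF assms(1)] normalize_gives_polynomial[OF assms(2)]]
    by (simp flip: normalize_coeff)
  then show ?thesis using assms eval_normalize by metis
qed

lemma pderiv_mem_additive_closed:
  assumes "set p \<subseteq> F" "\<And>n a. a \<in> F \<Longrightarrow> [(n::nat)] \<cdot> a \<in> F"
  shows "set (pderiv p) \<subseteq> F"
  using assms(1)
proof (induct p rule: pderiv.induct)
  case (3 a b p)
  then show ?case using assms(2)[of a "length (b # p)"] by auto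
qed auto

end

context cring
begin

lemma eval_map_smult:
  assumes "set p \<subseteq> carrier R" "c \<in> carrier R" "x \<in> carrier R"
  shows "eval (map ((\<otimes>) c) p) x = c \<otimes> eval p x"
  using assms(1)
proof (induct p)
  case (Cons a p)
  then show ?case using assms(2,3) eval_in_carrier[of p x] by (simp add: r_distr m_assoc)
qed (use assms in auto)

text \<open>Appending \<open>c\<close> turns \<open>p\<close> into \<open>X p + c\<close>, so this
  is the product rule for the factor \<open>X\<close>.\<close>

lemma eval_pderiv_snoc:
  assumes "set p \<subseteq> carrier R" "c \<in> carrier R" "x \<in> carrier R"
  shows "eval (pderiv (p @ [c])) x = eval p x \<oplus> x \<otimes> eval (pderiv p) x"
  using assms(1)
proof (induct p rule: pderiv.induct)
  case 1 then show ?case using assms by simp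
next
  case (2 a) then show ?case using assms by simp
next
  case (3 a b p)
  let ?n = "length p"
  have bp: "set (b # p) \<subseteq> carrier R" "a \<in> carrier R" using 3 by auto
  define u where "u = eval (b # p) x"
  define v where "v = eval (pderiv (b # p)) x"
  have uv: "u \<in> carrier R" "v \<in> carrier R"
    unfolding u_def v_def using eval_in_carrier[OF bp(1) assms(3)]
      eval_in_carrier[OF pderiv_in_carrier[OF bp(1)] assms(3)] by auto
  have IH: "eval (pderiv (b # p @ [c])) x = u \<oplus> x \<otimes> v"
    using 3(1)[OF bp(1)] unfolding u_def v_def by simp
  have L: "eval (pderiv ((a # b # p) @ [c])) x
      = ([Suc (Suc ?n)] \<cdot> a \<otimes> x [^] Suc ?n) \<oplus> (u \<oplus> x \<otimes> v)"
    using IH by (cases p) (auto simp: length_pderiv)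
  have R1: "eval (a # b # p) x = a \<otimes> x [^] Suc ?n \<oplus> u"
    unfolding u_def by simp
  have R2: "eval (pderiv (a # b # p)) x = [Suc ?n] \<cdot> a \<otimes> x [^] ?n \<oplus> v"
    unfolding v_def by (simp add: length_pderiv)
  define w where "w = [Suc ?n] \<cdot> a"
  have w: "w \<in> carrier R" "[Suc (Suc ?n)] \<cdot> a = w \<oplus> a" unfolding w_def using bp by auto
  define z where "z = x [^] ?n"
  have z: "z \<in> carrier R" "x [^] Suc ?n = z \<otimes> x" unfolding z_def using assms by auto
  show ?case unfolding L R1 R2 w_def[symmetric] w(2) z(2) z_def[symmetric]
    using w(1) z(1) uv bp assms(3) by algebra
qed

text \<open>The derivative of \<open>(X - a) g\<close> is \<open>g + (X - a) g'\<close>, and the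
  second term vanishes at \<open>a\<close>. The product is split coefficientwise into
  \<open>X g\<close> and \<open>- a g\<close>, since the lists involved have different
  lengths.\<close>

lemma eval_pderiv_linear_factor:
  assumes g: "set g \<subseteq> carrier R" and a: "a \<in> carrier R"
  shows "eval (pderiv (poly_mult [\<one>, \<ominus> a] g)) a = eval g a"
proof -
  let ?p = "g @ [\<zero>]" and ?q = "map ((\<otimes>) (\<ominus> a)) g"
  have c: "set ?p \<subseteq> carrier R" "set ?q \<subseteq> carrier R" "set (pderiv ?p) \<subseteq> carrier R" "set (pderiv ?q) \<subseteq> carrier R"
    using g a pderiv_in_carrier[of ?p] pderiv_in_carrier[of ?q] by auto
  have m: "set (poly_mult [\<one>, \<ominus> a] g) \<subseteq> carrier R"
    by (rule poly_mult_in_carrier) (use g a in auto)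
  have P: "coeff (poly_mult [\<one>, \<ominus> a] g) = (\<lambda>i. coeff ?p i \<oplus> coeff ?q i)"
  proof -
    have "coeff (poly_mult [\<one>, \<ominus> a] g)
       = coeff (poly_add (map ((\<otimes>) \<one>) g @ [\<zero>]) (poly_add ?q []))"
      by (simp del: poly_add.simps)
    also have "map ((\<otimes>) \<one>) g = g" using g by (induct g) auto
    also have "coeff (poly_add (g @ [\<zero>]) (poly_add ?q [])) = (\<lambda>i. coeff ?p i \<oplus> coeff (poly_add ?q []) i)"
      by (rule poly_add_coeff) (use c poly_add_in_carrier[of ?q "[]"] in \<open>auto simp del: poly_add.simps\<close>)
    also have "coeff (poly_add ?q []) = coeff ?q"
      using c(2) by (subst poly_add_coeff) auto
    finally show ?thesis .
  qed
  define F where "F = poly_mult [\<one>, \<ominus> a] g"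
  define G where "G = poly_add (pderiv ?p) (pderiv ?q)"
  have GG: "set G \<subseteq> carrier R" "coeff G = (\<lambda>i. coeff (pderiv ?p) i \<oplus> coeff (pderiv ?q) i)"
    unfolding G_def using poly_add_in_carrier poly_add_coeff c by blast+
  have "coeff (pderiv F) i = coeff G i" for i
    unfolding coeff_pderiv[OF m, folded F_def] P[folded F_def] GG(2) coeff_pderiv[OF c(1)] coeff_pderiv[OF c(2)]
    by (rule add.nat_pow_distrib) (use c in auto)
  then have "eval (pderiv F) a = eval G a"
    using pderiv_in_carrier[OF m, folded F_def] GG(1) a by (intro eval_eq_if_coeff_eq) auto
  then have "eval (pderiv (poly_mult [\<one>, \<ominus> a] g)) a = eval (poly_add (pderiv ?p) (pderiv ?q)) a"
    unfolding F_def G_def .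
  also have "\<dots> = eval (pderiv ?p) a \<oplus> eval (pderiv ?q) a"
    using eval_poly_add[OF c(3,4) a] .
  also have "eval (pderiv ?p) a = eval g a \<oplus> a \<otimes> eval (pderiv g) a"
    using eval_pderiv_snoc[OF g _ a] by simp
  also have "eval (pderiv ?q) a = eval (map ((\<otimes>) (\<ominus> a)) (pderiv g)) a"
  proof (rule eval_eq_if_coeff_eq)
    show "coeff (pderiv ?q) = coeff (map ((\<otimes>) (\<ominus> a)) (pderiv g))"
    proof
      fix i
      show "coeff (pderiv ?q) i = coeff (map ((\<otimes>) (\<ominus> a)) (pderiv g)) i"
        using a g by (simp add: coeff_pderiv[OF c(2)] coeff_pderiv[OF g] scalar_coeff add_pow_rdistr del: add.nat_pow_Suc)
    qed
  qed (use c a g pderiv_in_carrier[OF g] in auto)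
  also have "\<dots> = (\<ominus> a) \<otimes> eval (pderiv g) a"
    using eval_map_smult[OF pderiv_in_carrier[OF g] _ a] a by simp
  finally show ?thesis
    using eval_in_carrier[OF g a] eval_in_carrier[OF pderiv_in_carrier[OF g] a] a by algebra
qed

end

section \<open>Minimal polynomials over intermediate fields and simplicity of their roots\<close>

locale perfect_closure = algebraic_closure R K for R :: "'a ring" (structure) and K +
  assumes perfect: "perfect_subfield R K"
begin

abbreviation intermediate :: "'a set \<Rightarrow> bool" where
  "intermediate F \<equiv> subfield F R \<and> K \<subseteq> F"

lemma intermediate_base: "intermediate K"
  using subfield_axioms by simp

lemma algebraic_over_intermediate:
  assumes "K \<subseteq> F" "x \<in> carrier R"
  shows "(algebraic over F) x"
  using algebraic_mono[OF assms(1) algebraic_extension[OF assms(2)]] .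

lemma Irr_props:
  assumes "intermediate F" "x \<in> carrier R"
  shows "Irr F x \<in> carrier (F[X])" "Irr F x \<in> carrier (poly_ring R)" "Irr F x \<noteq> []"
    "set (Irr F x) \<subseteq> F" "eval (Irr F x) x = \<zero>" "lead_coeff (Irr F x) = \<one>" "degree (Irr F x) \<ge> 1"
proof -
  have alg: "(algebraic over F) x" and sub: "subfield F R"
    using algebraic_over_intermediate assms by auto
  note I = IrrE[OF sub assms(2) alg]
  show 1: "Irr F x \<in> carrier (F[X])" "eval (Irr F x) x = \<zero>" "lead_coeff (Irr F x) = \<one>"
    using I by auto
  show "Irr F x \<in> carrier (poly_ring R)"
    using carrier_polynomial_shell[OF subfieldE(1)[OF sub] 1(1)] .
  show "Irr F x \<noteq> []"
    using pirreducibleE(1)[OF subfieldE(1)[OF sub] I(1,2)] .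
  show "set (Irr F x) \<subseteq> F"
    using 1(1) polynomial_incl unfolding univ_poly_carrier[symmetric] by blast
  show "degree (Irr F x) \<ge> 1"
    using pirreducible_degree[OF sub I(1,2)] .
qed

lemma carrier_polyI:
  assumes "subfield F R" "set p \<subseteq> F"
  shows "normalize p \<in> carrier (F[X])" "normalize p \<in> carrier (poly_ring R)"
  using normalize_gives_polynomial[OF assms(2)] carrier_polynomial_shell[OF subfieldE(1)[OF assms(1)]]
  unfolding univ_poly_carrier by blast+

lemma Irr_dvd:
  assumes "intermediate F" "x \<in> carrier R" "set p \<subseteq> F" "eval p x = \<zero>"
  shows "Irr F x pdivides normalize p"
proof (rule Irr_minimal)
  show "eval (normalize p) x = \<zero>"
    using assms subfieldE(3) by (subst eval_normalize) auto
qed (use assms algebraic_over_intermediate carrier_polyI in auto)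

text \<open>\<open>Irr F x\<close> divides every polynomial over \<open>F\<close> that vanishes at
  \<open>x\<close>, so a conjugate of \<open>x\<close> satisfies all equations over \<open>F\<close>
  that \<open>x\<close> satisfies. This is the source of every later statement on conjugates over
  varying fields.\<close>

lemma root_of_multiple:
  assumes "intermediate F" "x \<in> carrier R" "y \<in> carrier R" "set p \<subseteq> F" "eval p x = \<zero>"
    "eval (Irr F x) y = \<zero>"
  shows "eval p y = \<zero>"
proof -
  have "eval (normalize p) y = \<zero>"
    using pdivides_imp_root_sharing[OF Irr_props(2) Irr_dvd] assms by blast
  then show ?thesis
    using assms subfieldE(3) by (subst (asm) eval_normalize) auto
qed

lemma Irr_degree_le:
  assumes "intermediate F" "x \<in> carrier R" "set p \<subseteq> F" "eval p x = \<zero>" "normalize p \<noteq> []"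
  shows "length (Irr F x) \<le> length p"
proof -
  have "degree (Irr F x) \<le> degree (normalize p)"
    using pdivides_imp_degree_le[OF carrier_is_subring _ _ _ Irr_dvd[OF assms(1-4)]]
      Irr_props(2)[OF assms(1,2)] carrier_polyI(2)[OF _ assms(3)] assms by auto
  then have "length (Irr F x) \<le> length (normalize p)"
    using assms(5) by (cases "normalize p") auto
  then show ?thesis using normalize_length_le[of p] by simp
qed

lemma Irr_eq_if_root:
  assumes "intermediate F" "x \<in> carrier R" "y \<in> carrier R" "eval (Irr F x) y = \<zero>"
  shows "Irr F y = Irr F x"
proof -
  note sub = conjunct1[OF assms(1)]
  have alg: "(algebraic over F) z" if "z \<in> carrier R" for z
    using algebraic_over_intermediate assms that by auto
  show ?thesis
    using minimal_polynomial_is_unique[OF sub assms(3) alg[OF assms(3)]]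
      IrrE[OF sub assms(2) alg[OF assms(2)]] IrrE[OF sub assms(3) alg[OF assms(3)]] assms(4)
    by blast
qed

lemma Irr_pdivides_Irr:
  assumes "intermediate F" "intermediate F'" "F \<subseteq> F'" "x \<in> carrier R"
  shows "Irr F' x pdivides Irr F x"
proof -
  have "normalize (Irr F x) = Irr F x"
    using Irr_props(1)[OF assms(1,4)] normalize_polynomial unfolding univ_poly_carrier[symmetric] by blast
  then show ?thesis
    using Irr_dvd[OF assms(2,4), of "Irr F x"] Irr_props[OF assms(1,4)] assms(3) by auto
qed

lemma nat_pow_eq_zeroD:
  assumes "a \<in> carrier R" "a [^] (n::nat) = \<zero>"
  shows "a = \<zero>"
  using assms(2)
proof (induct n)
  case (Suc n)
  then show ?case using integral[of "a [^] n" a] assms(1) by auto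
qed simp

text \<open>A multiple root gives \<open>f = (X - a) ((X - a) q)\<close>; the derivative at
  \<open>a\<close> is the value of the cofactor \<open>(X - a) q\<close>, which is zero.\<close>

lemma eval_pderiv_multiple_root:
  assumes "f \<in> carrier (poly_ring R)" "f \<noteq> []" "a \<in> carrier R" "alg_mult f a > 1"
  shows "eval (pderiv f) a = \<zero>"
proof -
  interpret UP: domain "poly_ring R" using univ_poly_is_domain[OF carrier_is_subring] .
  let ?l = "[\<one>, \<ominus> a]"
  have l: "?l \<in> carrier (poly_ring R)" using assms(3)
    unfolding univ_poly_carrier[symmetric] polynomial_def by auto
  have "?l [^]\<^bsub>poly_ring R\<^esub> (2::nat) pdivides f"
    using le_alg_mult_imp_pdivides[OF assms(3,1)] assms(4) by simp
  then obtain q where q: "q \<in> carrier (poly_ring R)"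
    and "f = (?l [^]\<^bsub>poly_ring R\<^esub> (2::nat)) \<otimes>\<^bsub>poly_ring R\<^esub> q"
    unfolding pdivides_def factor_def by auto
  then have f: "f = ?l \<otimes>\<^bsub>poly_ring R\<^esub> (?l \<otimes>\<^bsub>poly_ring R\<^esub> q)"
    using l q by (simp add: numeral_2_eq_2 UP.m_assoc)
  have g: "?l \<otimes>\<^bsub>poly_ring R\<^esub> q \<in> carrier (poly_ring R)" using l q by simp
  then have "set (?l \<otimes>\<^bsub>poly_ring R\<^esub> q) \<subseteq> carrier R"
    using polynomial_incl unfolding univ_poly_carrier[symmetric] by blast
  then have "eval (pderiv f) a = eval (?l \<otimes>\<^bsub>poly_ring R\<^esub> q) a"
    unfolding f univ_poly_mult using eval_pderiv_linear_factor[OF _ assms(3)] by blast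
  also have "\<dots> = eval ?l a \<otimes> eval q a"
    using ring_hom_memE(2)[OF eval_is_hom[OF carrier_is_subring assms(3)] l q] .
  also have "\<dots> = \<zero>"
    using assms(3) eval_in_carrier[OF _ assms(3), of q] q polynomial_incl
    unfolding univ_poly_carrier[symmetric] by (auto simp: r_neg)
  finally show ?thesis .
qed

text \<open>If only exponents divisible by \<open>p\<close> occur and coefficients have
  \<open>p\<close>-th roots, additivity of the Frobenius map makes \<open>f\<close> the
  \<open>p\<close>-th power of the polynomial with these roots as coefficients and all exponents
  divided by \<open>p\<close>. The length bound says that \<open>length g\<close> is at most
  \<open>length f / p\<close> rounded up.\<close>

lemma eval_as_prime_power:
  assumes p: "Factorial_Ring.prime (p::nat)" and char: "[p] \<cdot> \<one> = \<zero>"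
    and root: "\<forall>x\<in>K. \<exists>y\<in>K. y [^] p = x"
  shows "set f \<subseteq> K \<Longrightarrow> (\<And>i. coeff f i \<noteq> \<zero> \<Longrightarrow> p dvd i) \<Longrightarrow>
    \<exists>g. set g \<subseteq> K \<and> p * length g < length f + p \<and> (f \<noteq> [] \<and> hd f \<noteq> \<zero> \<longrightarrow> g \<noteq> [] \<and> hd g \<noteq> \<zero>)
      \<and> (\<forall>y\<in>carrier R. eval f y = eval g y [^] p)"
proof (induct f)
  case Nil
  then show ?case using prime_gt_0_nat[OF p] by (intro exI[of _ "[]"]) (auto simp: nat_pow_zero)
next
  case (Cons a f)
  have K: "K \<subseteq> carrier R" using subfieldE(3)[OF subfield_axioms] .
  have p0: "p > 0" using prime_gt_0_nat[OF p] .
  have c: "p dvd i" if "coeff f i \<noteq> \<zero>" for i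
    using Cons(3)[of i] that coeff_length[of f] by (cases "i = length f") auto
  obtain g where g: "set g \<subseteq> K" "p * length g < length f + p"
    "\<forall>y\<in>carrier R. eval f y = eval g y [^] p"
    using Cons(1)[OF _ c] Cons(2) by auto
  show ?case
  proof (cases "a = \<zero>")
    case True
    have "eval (a # f) y = eval f y" if "y \<in> carrier R" for y
      using True that eval_in_carrier[of f y] Cons(2) K by auto
    then show ?thesis using g True by (intro exI[of _ g]) auto
  next
    case False
    then have "p dvd length f" using Cons(3)[of "length f"] by simp
    then obtain m where m: "length f = p * m" by blast
    have "p * length g < p * Suc m" using g(2) m by simp
    then have "length g < Suc m" by (simp only: mult_less_cancel1)
    then have lm: "length g \<le> m" by simp
    obtain b where b: "b \<in> K" "b [^] p = a" using root Cons(2) by auto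
    have b0: "b \<noteq> \<zero>" using False b nat_pow_zero[of p] p0 by auto
    \<comment> \<open>The coefficient \<open>a\<close> sits at exponent
      \<open>length f = p * m\<close>, so its root \<open>b\<close> belongs at exponent
      \<open>m\<close>; zeros fill the gap above the exponents of \<open>g\<close>.\<close>
    let ?h = "b # (replicate (m - length g) \<zero> @ g)"
    have z: "\<zero> \<in> K" using subringE(2)[OF subfieldE(1)[OF subfield_axioms]] .
    show ?thesis
    proof (intro exI[of _ ?h] conjI ballI impI)
      show "set ?h \<subseteq> K" using b g z by auto
      show "p * length ?h < length (a # f) + p" using lm m by simp
      fix y assume y: "y \<in> carrier R"
      have gy: "eval g y \<in> carrier R" using eval_in_carrier[of g y] g K y by auto
      have by': "b \<otimes> y [^] m \<in> carrier R" using b K y by auto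
      have "eval ?h y = b \<otimes> y [^] m \<oplus> eval g y"
        using eval_replicate[of g y "m - length g"] g K y lm by auto
      then have "eval ?h y [^] p = (b \<otimes> y [^] m) [^] p \<oplus> eval f y"
        using frobenius_add[OF p char by' gy] g(3) y by simp
      also have "(b \<otimes> y [^] m) [^] p = a \<otimes> y [^] length f"
        using b K y m by (auto simp: nat_pow_distrib nat_pow_pow mult.commute)
      finally show "eval (a # f) y = eval ?h y [^] p" by simp
    qed (use b0 in auto)
  qed
qed

text \<open>A multiple root \<open>a\<close> has the same minimal polynomial as \<open>x\<close> and
  is a root of the derivative, so the derivative is zero. In characteristic zero this contradicts
  the leading coefficient. In characteristic \<open>p\<close> the minimal polynomial becomes a
  \<open>p\<close>-th power, and its \<open>p\<close>-th root is a shorter polynomial over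
  \<open>K\<close> that vanishes at \<open>a\<close>.\<close>

lemma Irr_no_multiple_root_base:
  assumes x: "x \<in> carrier R"
  shows "alg_mult (Irr K x) a \<le> 1"
proof (rule ccontr)
  assume "\<not> ?thesis"
  then have m: "alg_mult (Irr K x) a > 1" by simp
  let ?f = "Irr K x"
  note I = Irr_props[OF intermediate_base x]
  have a: "a \<in> carrier R" using m unfolding alg_mult_def by (auto split: if_splits)
  have K: "K \<subseteq> carrier R" using subfieldE(3)[OF subfield_axioms] .
  have fa: "eval ?f a = \<zero>"
    using alg_mult_gt_zero_iff_is_root[OF I(2)] m unfolding is_root_def by (metis less_trans zero_less_one)
  have Ia: "Irr K a = ?f" using Irr_eq_if_root[OF intermediate_base x a fa] .
  have d: "eval (pderiv ?f) a = \<zero>" using eval_pderiv_multiple_root[OF I(2,3) a m] .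
  have add: "[n] \<cdot> k \<in> K" if "k \<in> K" for n :: nat and k
    using that subringE(2,7)[OF subfieldE(1)[OF subfield_axioms]] by (induct n) auto
  have dK: "set (pderiv ?f) \<subseteq> K"
    using pderiv_mem_additive_closed[OF I(4) add] by blast
  \<comment> \<open>The derivative is shorter than the minimal polynomial of \<open>a\<close>, so it
    can vanish at \<open>a\<close> only by being the zero polynomial.\<close>
  have "normalize (pderiv ?f) = []"
    using Irr_degree_le[OF intermediate_base a dK d] Ia I(7) by (fastforce simp: length_pderiv)
  then have c0: "coeff (pderiv ?f) i = \<zero>" for i
    using normalize_coeff[of "pderiv ?f"] by simp
  have fc: "set ?f \<subseteq> carrier R" using I(4) K by auto
  have c: "[i] \<cdot> coeff ?f i = \<zero>" if "i > 0" for i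
    using c0[of "i - 1"] that unfolding coeff_pderiv[OF fc] by simp
  have top: "coeff ?f (degree ?f) = \<one>" using lead_coeff_simp[OF I(3)] I(6) by simp
  have deg: "[degree ?f] \<cdot> \<one> = \<zero>" using c[of "degree ?f"] top I(7) by simp
  show False
  proof (cases "\<forall>n::nat. n > 0 \<longrightarrow> [n] \<cdot> \<one> \<noteq> \<zero>")
    case True then show False using deg I(7) by auto
  next
    case False
    then obtain p :: nat where p: "Factorial_Ring.prime p" "[p] \<cdot> \<one> = \<zero>" "\<forall>x\<in>K. \<exists>y\<in>K. y [^] p = x"
      using perfect unfolding perfect_subfield_def by blast
    \<comment> \<open>Both \<open>i\<close> and \<open>p\<close> annihilate the coefficient; were
      they coprime, Bezout would make 1 annihilate it too.\<close>
    have dvd: "p dvd i" if "coeff ?f i \<noteq> \<zero>" for i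
    proof (rule ccontr)
      assume n: "\<not> p dvd i"
      then have i0: "i \<noteq> 0" by (metis dvd_0_right)
      have "coprime i p" using n p(1) by (meson coprime_commute prime_imp_coprime_nat)
      then obtain u v where uv: "u * i = v * p + 1"
        using bezout_nat[OF i0, of p] by (auto simp: mult.commute)
      let ?c = "coeff ?f i"
      have cc: "?c \<in> carrier R" using fc by simp
      have "[(u * i)] \<cdot> ?c = \<zero>" using c[of i] i0 cc
        by (metis add.nat_pow_one add.nat_pow_pow gr0I mult.commute)
      moreover have "[(v * p + 1)] \<cdot> ?c = ?c"
        using add_pow_dvd_zero[OF p(2), of "v * p" ?c] cc by (simp flip: add.nat_pow_mult)
      ultimately show False using uv that by simp
    qed
    obtain g where g: "set g \<subseteq> K" "p * length g < length ?f + p" "g \<noteq> []" "hd g \<noteq> \<zero>"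
      "\<forall>y\<in>carrier R. eval ?f y = eval g y [^] p"
      using eval_as_prime_power[OF p I(4) dvd] I(3,6) by auto
    have "eval g a \<in> carrier R" using eval_in_carrier[of g a] g K a by auto
    moreover have "eval g a [^] p = \<zero>" using g(5) a fa by simp
    ultimately have ga: "eval g a = \<zero>" by (rule nat_pow_eq_zeroD)
    have "normalize g = g" using g by (cases g) auto
    then have "length ?f \<le> length g"
      using Irr_degree_le[OF intermediate_base a g(1) ga] g(3) Ia by simp
    \<comment> \<open>Equivalently \<open>(p - 1) * (length ?f - 1) < 1\<close>, impossible because
      both \<open>p\<close> and \<open>length ?f\<close> are at least 2.\<close>
    then have "p * length ?f < length ?f + p"
      using g(2) by (meson le_less_trans mult_le_mono2)
    moreover obtain s where "p = Suc (Suc s)" using prime_ge_2_nat[OF p(1)] by (metis add_2_eq_Suc le_Suc_ex)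
    moreover obtain t where "length ?f = Suc (Suc t)" using I(7) by (metis Suc_diff_1 Suc_le_D diff_0_eq_0 gr0I le_zero_eq One_nat_def zero_neq_one)
    ultimately show False by simp
  qed
qed

lemma Irr_no_multiple_root:
  assumes "intermediate F" "x \<in> carrier R"
  shows "alg_mult (Irr F x) a \<le> 1"
proof -
  have "roots (Irr F x) \<subseteq># roots (Irr K x)"
    using pdivides_imp_roots_incl[OF Irr_props(2)[OF assms] Irr_props(2,3)[OF intermediate_base assms(2)]]
      Irr_pdivides_Irr[OF intermediate_base assms(1) _ assms(2)] assms(1) by blast
  then have "alg_mult (Irr F x) a \<le> alg_mult (Irr K x) a"
    using alg_mult_eq_count_roots Irr_props(2)[OF assms] Irr_props(2)[OF intermediate_base assms(2)]
    by (simp add: mset_subset_eq_count)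
  then show ?thesis using Irr_no_multiple_root_base[OF assms(2), of a] by simp
qed

definition conjugates :: "'a set \<Rightarrow> 'a \<Rightarrow> 'a set" where
  "conjugates F x = {y \<in> carrier R. eval (Irr F x) y = \<zero>}"

text \<open>\<open>R\<close> is algebraically closed, so \<open>Irr F x\<close> has as many roots
  with multiplicity as its degree; since all roots are simple, the multiset of roots is a
  set.\<close>

lemma card_conjugates:
  assumes "intermediate F" "x \<in> carrier R"
  shows "finite (conjugates F x)" "card (conjugates F x) = degree (Irr F x)"
proof -
  note I = Irr_props[OF assms]
  have c: "conjugates F x = set_mset (roots (Irr F x))"
    using roots_mem_iff_is_root[OF I(2)] I(3) unfolding conjugates_def is_root_def by auto
  then show "finite (conjugates F x)" by simp
  have "count (roots (Irr F x)) y \<le> 1" for y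
    using Irr_no_multiple_root[OF assms] alg_mult_eq_count_roots[OF I(2)] by simp
  then have "roots (Irr F x) = mset_set (set_mset (roots (Irr F x)))"
    by (intro multiset_eqI) (auto simp: count_mset_set' le_Suc_eq not_in_iff intro: antisym)
  then have "card (conjugates F x) = size (roots (Irr F x))"
    unfolding c by (metis size_mset_set)
  then show "card (conjugates F x) = degree (Irr F x)"
    using roots_over_carrier[OF I(2)] unfolding splitted_def by simp
qed

end

section \<open>Primitive elements and conjugates\<close>

context perfect_closure
begin

lemma simple_extension_props:
  assumes "intermediate F" "x \<in> carrier R"
  shows "intermediate (simple_extension F x)" "F \<subseteq> simple_extension F x" "x \<in> simple_extension F x"
    "finite_dimension F (simple_extension F x)" "dim F (simple_extension F x) = degree (Irr F x)"
proof -
  have alg: "(algebraic over F) x" and sub: "subfield F R" and K: "K \<subseteq> F"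
    using algebraic_over_intermediate assms by auto
  show 1: "F \<subseteq> simple_extension F x"
    using simple_extension_incl[OF subfieldE(3)[OF sub] assms(2)] .
  show "intermediate (simple_extension F x)"
    using simple_extension_is_subfield[OF sub assms(2)] alg 1 K by auto
  show "x \<in> simple_extension F x" using simple_extension_mem[OF subfieldE(1)[OF sub] assms(2)] .
  show "finite_dimension F (simple_extension F x)"
    using finite_dimension_simple_extension[OF sub assms(2)] alg by simp
  show "dim F (simple_extension F x) = degree (Irr F x)"
    using simple_extension_dim[OF sub assms(2) alg] unfolding over_def .
qed

text \<open>An element without further conjugates has a minimal polynomial of degree one, because
  conjugates are counted by the degree.\<close>

lemma memI_conjugates:
  assumes F: "intermediate F" and x: "x \<in> carrier R" and c: "conjugates F x \<subseteq> {x}"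
  shows "x \<in> F"
proof -
  have sub: "subfield F R" using F by simp
  have "card (conjugates F x) \<le> card {x}" using c by (intro card_mono) auto
  then have "degree (Irr F x) = 1" using card_conjugates(2)[OF F x] Irr_props(7)[OF F x] by auto
  then obtain w where w: "eval (Irr F x) (\<ominus> w) = \<zero>" "w \<in> F"
    using degree_one_root[OF sub Irr_props(1)[OF F x]] by metis
  have wF: "\<ominus> w \<in> F" by (rule subringE(5)[OF subfieldE(1)[OF sub] w(2)])
  then have "\<ominus> w \<in> conjugates F x"
    using w(1) subfieldE(3)[OF sub] unfolding conjugates_def by blast
  then have "\<ominus> w = x" using c by blast
  then show ?thesis using wF by (rule subst)
qed

lemma simple_extension_least:
  assumes "subfield M R" "F \<subseteq> M" "x \<in> M"
  shows "simple_extension F x \<subseteq> M"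
  using simple_extension_subring_incl[OF subfieldE(1)[OF assms(1)] assms(2,3)] .

lemma generate_field_insert:
  assumes "intermediate F" "x \<in> carrier R"
  shows "generate_field R (insert x F) = simple_extension F x"
proof (rule generate_fieldI[symmetric])
  show "insert x F \<subseteq> carrier R" using assms subfieldE(3) by blast
  show "subfield (simple_extension F x) R" "insert x F \<subseteq> simple_extension F x"
    using simple_extension_props[OF assms] by auto
  fix M assume "subfield M R" "insert x F \<subseteq> M"
  then show "simple_extension F x \<subseteq> M" using simple_extension_least by auto
qed

text \<open>The composite of \<open>p\<close> with \<open>u + v X\<close>, described by its values
  alone. The primitive element argument needs it to view \<open>a = c - k b\<close> as an equation
  for \<open>b\<close> over \<open>K(c)\<close>.\<close>

lemma eval_affine_substitution:
  assumes F: "subfield F R" and p: "set p \<subseteq> F" and u: "u \<in> F" and v: "v \<in> F"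
  shows "\<exists>q. set q \<subseteq> F \<and> (\<forall>y\<in>carrier R. eval q y = eval p (u \<oplus> v \<otimes> y))"
  using p
proof (induct p)
  case Nil show ?case by (intro exI[of _ "[]"]) auto
next
  case (Cons a p)
  note sub = subfieldE(1)[OF F]
  have FR: "F \<subseteq> carrier R" using subfieldE(3)[OF F] .
  have mult: "set (poly_mult p q) \<subseteq> F" and add: "set (poly_add p q) \<subseteq> F" if "set p \<subseteq> F" "set q \<subseteq> F" for p q
    using polynomial_incl poly_mult_is_polynomial[OF sub that] poly_add_is_polynomial[OF sub that] by auto
  have pow: "\<exists>q. set q \<subseteq> F \<and> (\<forall>y\<in>carrier R. eval q y = (u \<oplus> v \<otimes> y) [^] n)" for n :: nat
  proof (induct n)
    case 0 show ?case using subringE(3)[OF sub] by (intro exI[of _ "[\<one>]"]) auto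
  next
    case (Suc n)
    then obtain q where q: "set q \<subseteq> F" "\<forall>y\<in>carrier R. eval q y = (u \<oplus> v \<otimes> y) [^] n" by blast
    have "eval (poly_mult q [v, u]) y = (u \<oplus> v \<otimes> y) [^] Suc n" if "y \<in> carrier R" for y
    proof -
      have "eval (poly_mult q [v, u]) y = eval q y \<otimes> eval [v, u] y"
        by (rule eval_poly_mult) (use q u v FR that in auto)
      also have "eval [v, u] y = u \<oplus> v \<otimes> y"
        using u v subsetD[OF FR] that by (auto simp: a_comm)
      finally show ?thesis using q(2) that by simp
    qed
    then show ?case using mult[OF q(1), of "[v, u]"] u v by (intro exI[of _ "poly_mult q [v, u]"]) auto
  qed
  obtain q where q: "set q \<subseteq> F" "\<forall>y\<in>carrier R. eval q y = eval p (u \<oplus> v \<otimes> y)" using Cons by auto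
  obtain r where r: "set r \<subseteq> F" "\<forall>y\<in>carrier R. eval r y = (u \<oplus> v \<otimes> y) [^] length p" using pow by blast
  let ?q = "poly_add (poly_mult [a] r) q"
  have a: "a \<in> F" using Cons by simp
  have "eval ?q y = eval (a # p) (u \<oplus> v \<otimes> y)" if y: "y \<in> carrier R" for y
  proof -
    have "eval ?q y = eval (poly_mult [a] r) y \<oplus> eval q y"
      by (rule eval_poly_add) (use mult[of "[a]" r] r(1) q(1) a FR y in auto)
    also have "eval (poly_mult [a] r) y = eval [a] y \<otimes> eval r y"
      by (rule eval_poly_mult) (use r(1) a FR y in auto)
    finally show ?thesis using q r y a FR by auto
  qed
  moreover have "set ?q \<subseteq> F"
    using add[OF mult[of "[a]" r] q(1)] r(1) a by (simp del: poly_add.simps poly_mult.simps)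
  ultimately show ?case by blast
qed

text \<open>Take \<open>c = a + k b\<close>. Over \<open>K(c)\<close> the element \<open>b\<close>
  is a common root of \<open>Irr K b\<close> and of \<open>Irr K a\<close> evaluated at
  \<open>c - k X\<close>. For all but finitely many \<open>k\<close> it is the only one, so
  \<open>b\<close> has no other conjugate over \<open>K(c)\<close> and lies in it, and so does
  \<open>a\<close>.\<close>

lemma primitive_element_two:
  assumes inf: "infinite K" and a: "a \<in> carrier R" and b: "b \<in> carrier R"
  shows "\<exists>c\<in>carrier R. simple_extension (simple_extension K b) a = simple_extension K c"
proof -
  note KK = intermediate_base
  have KR: "K \<subseteq> carrier R" using subfieldE(3)[OF subfield_axioms] .
  \<comment> \<open>These are the values of \<open>k\<close> for which \<open>c - k b'\<close> could
    be a conjugate \<open>a'\<close> of \<open>a\<close> with \<open>b'\<close> different from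
    \<open>b\<close>. The pairs with \<open>b' = b\<close> involve an inverse of zero; whatever its
    value, they add only finitely many exclusions.\<close>
  let ?S = "(\<lambda>(a', b'). (a' \<ominus> a) \<otimes> inv (b \<ominus> b')) ` (conjugates K a \<times> conjugates K b)"
  have "finite ?S" using card_conjugates(1)[OF KK] a b by auto
  then obtain k where k: "k \<in> K" "k \<notin> ?S" using inf finite_subset[of K ?S] by blast
  have kR: "k \<in> carrier R" using k(1) KR by blast
  define c where "c = a \<oplus> k \<otimes> b"
  have c: "c \<in> carrier R" unfolding c_def using a b k KR by auto
  let ?F = "simple_extension K c"
  note F = simple_extension_props[OF KK c]
  have kF: "k \<in> ?F" "\<ominus> k \<in> ?F" using F(1) k subringE(5)[OF subfieldE(1)] by auto
  obtain q where q: "set q \<subseteq> ?F" "\<forall>y\<in>carrier R. eval q y = eval (Irr K a) (c \<oplus> (\<ominus> k) \<otimes> y)"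
    using eval_affine_substitution[of ?F "Irr K a" c "\<ominus> k"] F kF Irr_props(4)[OF KK a] by blast
  have "c \<oplus> (\<ominus> k) \<otimes> b = a" unfolding c_def using a b kR by algebra
  then have qb: "eval q b = \<zero>" using q(2) b Irr_props(5)[OF KK a] by simp
  have "conjugates ?F b \<subseteq> {b}"
  proof
    fix y assume y: "y \<in> conjugates ?F b"
    then have yc: "y \<in> carrier R" and yI: "eval (Irr ?F b) y = \<zero>" unfolding conjugates_def by auto
    have "eval (Irr K b) y = \<zero>"
      using root_of_multiple[OF F(1) b yc _ _ yI, of "Irr K b"] Irr_props(4,5)[OF KK b] F(2) by auto
    then have yb: "y \<in> conjugates K b" using yc unfolding conjugates_def by simp
    have "eval q y = \<zero>" using root_of_multiple[OF F(1) b yc q(1) qb yI] .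
    then have ya: "c \<oplus> (\<ominus> k) \<otimes> y \<in> conjugates K a"
      using q(2) yc c kR unfolding conjugates_def by simp
    show "y \<in> {b}"
    proof (rule ccontr)
      assume "y \<notin> {b}"
      then have ne: "b \<ominus> y \<noteq> \<zero>" and yU: "b \<ominus> y \<in> carrier R" using b yc by auto
      have "(c \<oplus> (\<ominus> k) \<otimes> y) \<ominus> a = k \<otimes> (b \<ominus> y)"
        unfolding c_def using a b yc kR by algebra
      then have "((c \<oplus> (\<ominus> k) \<otimes> y) \<ominus> a) \<otimes> inv (b \<ominus> y) = k"
        using ne yU kR field_Units by (simp add: m_assoc)
      then have "k = (\<lambda>(a', b'). (a' \<ominus> a) \<otimes> inv (b \<ominus> b')) (c \<oplus> (\<ominus> k) \<otimes> y, y)" by simp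
      then have "k \<in> ?S" using ya yb by (intro image_eqI[of k _ "(c \<oplus> (\<ominus> k) \<otimes> y, y)"]) simp_all
      then show False using k by simp
    qed
  qed
  then have bF: "b \<in> ?F" by (rule memI_conjugates[OF F(1) b])
  have aF: "a \<in> ?F"
  proof -
    have "c \<oplus> (\<ominus> k) \<otimes> b \<in> ?F"
      using bF kF F(3) subringE(6,7)[OF subfieldE(1)[OF conjunct1[OF F(1)]]] by simp
    moreover have "c \<oplus> (\<ominus> k) \<otimes> b = a" unfolding c_def using a b kR by algebra
    ultimately show ?thesis by simp
  qed
  let ?M = "simple_extension (simple_extension K b) a"
  note B = simple_extension_props[OF KK b]
  note M = simple_extension_props[OF B(1) a]
  have "?M \<subseteq> ?F" using simple_extension_least[OF conjunct1[OF F(1)]] F(2) aF bF by simp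
  moreover have "c \<in> ?M"
  proof -
    have sub: "subring ?M R" and mem: "k \<in> ?M" "b \<in> ?M" using M(1,2) B(2,3) k(1) subfieldE(1) by auto
    show ?thesis unfolding c_def using subringE(6,7)[OF sub] mem M(3) by simp
  qed
  then have "?F \<subseteq> ?M" using simple_extension_least M(1) by auto
  ultimately show ?thesis using c by blast
qed

text \<open>A finite-dimensional space over a finite field is finite, and the multiplicative group
  of a finite field is cyclic; a generator of this group generates the extension.\<close>

lemma primitive_element_finite:
  assumes fin: "finite K" and ext: "finite_ext R K M"
  shows "\<exists>c\<in>M. simple_extension K c = M"
proof -
  have M: "subfield M R" "K \<subseteq> M" "finite_dimension K M" using ext unfolding finite_ext_def by auto
  obtain n where n: "dimension n K M" using M(3) by auto
  obtain Us where Us: "set Us \<subseteq> carrier R" "Span K Us = M"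
    using exists_base[OF subfield_axioms n] by blast
  have "M \<subseteq> (\<lambda>Ks. combine Ks Us) ` {Ks. set Ks \<subseteq> K \<and> length Ks = length Us}"
    using Span_eq_combine_set_length_version[OF subfield_axioms Us(1)] Us(2) by auto
  then have finM: "finite M"
    using finite_lists_length_eq[OF fin] by (meson finite_imageI finite_subset)
  interpret M: field "R\<lparr>carrier := M\<rparr>" using subfield_iff(2)[OF M(1)] .
  obtain c where c: "c \<in> carrier (mult_of (R\<lparr>carrier := M\<rparr>))"
    "carrier (mult_of (R\<lparr>carrier := M\<rparr>)) = {c [^]\<^bsub>R\<lparr>carrier := M\<rparr>\<^esub> i | i::nat. i \<in> UNIV}"
    using M.finite_field_mult_group_has_gen finM by auto
  have cM: "c \<in> M" using c(1) by simp
  have cR: "c \<in> carrier R" using cM subfieldE(3)[OF M(1)] by auto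
  note C = simple_extension_props[OF intermediate_base cR]
  have sub: "subring (simple_extension K c) R" using C(1) subfieldE(1) by auto
  have pow: "c [^] (i::nat) \<in> simple_extension K c" for i
    using C(3) subringE(3,6)[OF sub] by (induct i) auto
  have "M \<subseteq> simple_extension K c"
  proof
    fix x assume x: "x \<in> M"
    show "x \<in> simple_extension K c"
    proof (cases "x = \<zero>")
      case True then show ?thesis using subringE(2)[OF sub] by simp
    next
      case False
      then have "x \<in> carrier (mult_of (R\<lparr>carrier := M\<rparr>))" using x by simp
      then obtain i :: nat where "x = c [^]\<^bsub>R\<lparr>carrier := M\<rparr>\<^esub> i" using c(2) by auto
      then show ?thesis using pow by (simp flip: nat_pow_consistent)
    qed
  qed
  then show ?thesis using simple_extension_least[OF M(1,2) cM] cM by blast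
qed

text \<open>For infinite \<open>K\<close>, a spanning list of \<open>M\<close> is adjoined one
  element at a time, and each adjunction is collapsed into a simple extension.\<close>

theorem primitive_element:
  assumes ext: "finite_ext R K M"
  shows "\<exists>c\<in>M. simple_extension K c = M"
proof (cases "finite K")
  case True then show ?thesis using primitive_element_finite ext by blast
next
  case False
  have M: "subfield M R" "K \<subseteq> M" "finite_dimension K M" using ext unfolding finite_ext_def by auto
  have KR: "K \<subseteq> carrier R" using subfieldE(3)[OF subfield_axioms] .
  obtain n where n: "dimension n K M" using M(3) by auto
  obtain Us where Us: "set Us \<subseteq> carrier R" "Span K Us = M"
    using exists_base[OF subfield_axioms n] by blast
  have "set xs \<subseteq> carrier R \<Longrightarrow> \<exists>c\<in>carrier R. finite_extension K xs = simple_extension K c" for xs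
  proof (induct xs)
    case Nil
    have "K = simple_extension K \<zero>"
      using simple_extension_least[OF subfield_axioms _ subringE(2)[OF subfieldE(1)[OF subfield_axioms]], of K]
        simple_extension_incl[OF KR zero_closed] by simp
    then show ?case by auto
  next
    case (Cons x xs)
    then obtain b where b: "b \<in> carrier R" "finite_extension K xs = simple_extension K b" by auto
    then show ?case using primitive_element_two[OF False, of x b] Cons by simp
  qed
  then obtain c where c: "c \<in> carrier R" "finite_extension K Us = simple_extension K c" using Us by blast
  have UM: "set Us \<subseteq> M" using Span_base_incl[OF subfield_axioms Us(1)] Us(2) by simp
  have "finite_extension K Us \<subseteq> M"
    using finite_extension_subring_incl[OF subfieldE(1)[OF M(1)] M(2) UM] .
  moreover have "M \<subseteq> finite_extension K Us"
  proof -
    note sub = finite_extension_is_subring[OF subfieldE(1)[OF subfield_axioms] Us(1)]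
    have mem: "set Us \<subseteq> finite_extension K Us"
      using finite_extension_mem[OF subfieldE(1)[OF subfield_axioms] Us(1)] .
    have KI: "K \<subseteq> finite_extension K Us" using finite_extension_incl[OF KR Us(1)] .
    have "K <#> set Us \<subseteq> finite_extension K Us"
      using mem KI subringE(6)[OF sub] unfolding set_mult_def by blast
    then show ?thesis
      using Span_min[OF subfield_axioms Us(1) subring.axioms(1)[OF sub]] Us(2) by blast
  qed
  ultimately have "M = simple_extension K c" using c by simp
  then show ?thesis using simple_extension_props(3)[OF intermediate_base c(1)] by auto
qed

section \<open>Embeddings of simple extensions\<close>

lemma hom_eval:
  assumes "h \<in> ring_hom (R\<lparr>carrier := M\<rparr>) R" "subfield M R" "\<And>a. a \<in> F \<Longrightarrow> h a = a" "F \<subseteq> M"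
    "set p \<subseteq> F" "x \<in> M"
  shows "h (eval p x) = eval p (h x)"
proof -
  interpret h: ring_hom_ring "R\<lparr>carrier := M\<rparr>" R h
    using ring_hom_ringI2[OF _ ring_axioms assms(1)] subring_is_ring[OF subfieldE(1)[OF assms(2)]] by blast
  have "h (ring.eval (R\<lparr>carrier := M\<rparr>) p x) = eval (map h p) (h x)"
    using h.eval_hom'[of x p] assms(4-6) by auto
  moreover have "map h p = p" using assms(3,5) by (intro map_idI) auto
  ultimately show ?thesis unfolding eval_consistent[OF subfieldE(1)[OF assms(2)]] by simp
qed

lemma simple_extensionE:
  assumes "intermediate F" "x \<in> carrier R" "z \<in> simple_extension F x"
  obtains p where "p \<in> carrier (F[X])" "set p \<subseteq> F" "z = eval p x"
proof -
  obtain p where p: "p \<in> carrier (F[X])" "z = eval p x"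
    using simple_extension_as_eval_img[OF subfieldE(3)[OF conjunct1[OF assms(1)]] assms(2)] assms(3) by auto
  moreover have "set p \<subseteq> F" using p(1) polynomial_incl unfolding univ_poly_carrier[symmetric] by blast
  ultimately show thesis using that by blast
qed

text \<open>The map sends \<open>eval p x\<close> to \<open>eval p y\<close>. It does not depend on
  the chosen \<open>p\<close>: a difference of two choices vanishes at \<open>x\<close>, hence at
  the conjugate \<open>y\<close>.\<close>

lemma conjugate_hom:
  assumes F: "intermediate F" and x: "x \<in> carrier R" and y: "y \<in> conjugates F x"
  shows "\<exists>h. h \<in> ring_hom (R\<lparr>carrier := simple_extension F x\<rparr>) R \<and> (\<forall>a\<in>F. h a = a) \<and> h x = y"
proof -
  note sub = subfieldE(1)[OF conjunct1[OF F]]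
  have yc: "y \<in> carrier R" and yI: "eval (Irr F x) y = \<zero>" using y unfolding conjugates_def by auto
  interpret P: domain "F[X]" using univ_poly_is_domain[OF sub] .
  interpret ex: ring_hom_ring "F[X]" R "\<lambda>p. eval p x" using eval_ring_hom[OF sub x] .
  interpret ey: ring_hom_ring "F[X]" R "\<lambda>p. eval p y" using eval_ring_hom[OF sub yc] .
  have incl: "set p \<subseteq> F" if "p \<in> carrier (F[X])" for p
    using that polynomial_incl unfolding univ_poly_carrier[symmetric] by blast
  have wd: "eval p y = eval q y" if "p \<in> carrier (F[X])" "q \<in> carrier (F[X])" "eval p x = eval q x" for p q
  proof -
    let ?d = "p \<ominus>\<^bsub>F[X]\<^esub> q"
    have d: "?d \<in> carrier (F[X])" using that by simp
    have "eval ?d x = \<zero>" using that ex.hom_closed by (simp add: a_minus_def r_neg)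
    then have "eval ?d y = \<zero>" using root_of_multiple[OF F x yc incl[OF d] _ yI] by blast
    then have "eval p y \<ominus> eval q y = \<zero>" using that by (simp add: a_minus_def)
    then show ?thesis using that ey.hom_closed by (simp add: r_right_minus_eq)
  qed
  define h where "h z = eval (SOME p. p \<in> carrier (F[X]) \<and> eval p x = z) y" for z
  have h: "h (eval p x) = eval p y" if "p \<in> carrier (F[X])" for p
  proof -
    let ?q = "SOME q. q \<in> carrier (F[X]) \<and> eval q x = eval p x"
    have "?q \<in> carrier (F[X]) \<and> eval ?q x = eval p x"
      by (rule someI_ex) (use that in blast)
    then show ?thesis unfolding h_def using wd that by blast
  qed
  have "h \<in> ring_hom (R\<lparr>carrier := simple_extension F x\<rparr>) R"
  proof (rule ring_hom_memI)
    fix a assume "a \<in> carrier (R\<lparr>carrier := simple_extension F x\<rparr>)"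
    then have "a \<in> simple_extension F x" by simp
    then obtain p where p: "p \<in> carrier (F[X])" "a = eval p x" using simple_extensionE[OF F x] by blast
    show "h a \<in> carrier R" unfolding p(2) h[OF p(1)] using ey.hom_closed p(1) by blast
    fix b assume "b \<in> carrier (R\<lparr>carrier := simple_extension F x\<rparr>)"
    then have "b \<in> simple_extension F x" by simp
    then obtain q where q: "q \<in> carrier (F[X])" "b = eval q x" using simple_extensionE[OF F x] by blast
    show "h (a \<otimes>\<^bsub>R\<lparr>carrier := simple_extension F x\<rparr>\<^esub> b) = h a \<otimes> h b"
      using h[of "p \<otimes>\<^bsub>F[X]\<^esub> q"] h[OF p(1)] h[OF q(1)] p q by simp
    show "h (a \<oplus>\<^bsub>R\<lparr>carrier := simple_extension F x\<rparr>\<^esub> b) = h a \<oplus> h b"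
      using h[of "p \<oplus>\<^bsub>F[X]\<^esub> q"] h[OF p(1)] h[OF q(1)] p q by simp
  next
    show "h \<one>\<^bsub>R\<lparr>carrier := simple_extension F x\<rparr>\<^esub> = \<one>"
      using h[OF P.one_closed] by simp
  qed
  moreover have "h a = a" if a: "a \<in> F" for a
  proof -
    have n: "normalize [a] \<in> carrier (F[X])" using carrier_polyI(1)[of F "[a]"] F a by simp
    have aR: "a \<in> carrier R" using a F subfieldE(3) by blast
    then have "eval (normalize [a]) z = a" if "z \<in> carrier R" for z
      using that by (subst eval_normalize) auto
    then show ?thesis using h[OF n] x yc by simp
  qed
  moreover have "h x = y"
    using h[OF var_closed(1)[OF sub]] eval_var x yc by simp
  ultimately show ?thesis by blast
qed

lemma hom_simple_extension_cong:
  assumes F: "intermediate F" and x: "x \<in> carrier R"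
    and h: "h \<in> ring_hom (R\<lparr>carrier := simple_extension F x\<rparr>) R" "\<And>a. a \<in> F \<Longrightarrow> h a = a"
    and h': "h' \<in> ring_hom (R\<lparr>carrier := simple_extension F x\<rparr>) R" "\<And>a. a \<in> F \<Longrightarrow> h' a = a"
    and eq: "h x = h' x" and z: "z \<in> simple_extension F x"
  shows "h z = h' z"
proof -
  note E = simple_extension_props[OF F x]
  obtain p where p: "set p \<subseteq> F" "z = eval p x" using simple_extensionE[OF F x z] by blast
  show ?thesis unfolding p(2)
    using hom_eval[OF h(1) _ h(2) E(2) p(1) E(3)] hom_eval[OF h'(1) _ h'(2) E(2) p(1) E(3)] E(1) eq by simp
qed

end

section \<open>Automorphisms of an extension\<close>

context perfect_closure
begin

lemma eval_in_subfield:
  assumes "subfield M R" "set p \<subseteq> M" "x \<in> M"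
  shows "eval p x \<in> M"
  using ring.eval_in_carrier[OF subring_is_ring[OF subfieldE(1)[OF assms(1)]], of p x] assms
  by (simp add: eval_consistent[OF subfieldE(1)[OF assms(1)]])

lemma conjugates_mono:
  assumes "intermediate F" "intermediate F'" "F \<subseteq> F'" "x \<in> carrier R"
  shows "conjugates F' x \<subseteq> conjugates F x"
  using root_of_multiple[OF assms(2,4), of _ "Irr F x"] Irr_props(4,5)[OF assms(1,4)] assms(3)
  unfolding conjugates_def by auto

lemma self_conjugate: "intermediate F \<Longrightarrow> x \<in> carrier R \<Longrightarrow> x \<in> conjugates F x"
  using Irr_props(5) unfolding conjugates_def by simp

lemma galois_extI:
  assumes "intermediate F" "finite_ext R F M" "\<And>x. x \<in> M \<Longrightarrow> conjugates F x \<subseteq> M"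
  shows "galois_ext R F M"
proof -
  have "M \<subseteq> carrier R" using assms(2) subfieldE(3) unfolding finite_ext_def by blast
  then show ?thesis
    using assms(2,3) Irr_no_multiple_root[OF assms(1)]
    unfolding galois_ext_def normal_ext_def separable_ext_def conjugates_def by blast
qed

lemma Aut_hom:
  assumes "\<phi> \<in> Aut R F M"
  shows "\<phi> \<in> ring_hom (R\<lparr>carrier := M\<rparr>) (R\<lparr>carrier := M\<rparr>)" "bij_betw \<phi> M M" "\<phi> \<in> extensional M"
    "\<And>x. x \<in> F \<Longrightarrow> \<phi> x = x" "\<And>x. x \<in> M \<Longrightarrow> \<phi> x \<in> M"
  using assms unfolding Aut_def ring_iso_def by (auto dest: ring_hom_memE bij_betwE)

lemma Aut_hom_R:
  assumes "\<phi> \<in> Aut R F M" "subfield M R"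
  shows "\<phi> \<in> ring_hom (R\<lparr>carrier := M\<rparr>) R"
  using Aut_hom(1)[OF assms(1)] subfieldE(3)[OF assms(2)]
  by (auto simp: ring_hom_def)

lemma Aut_eval:
  assumes "\<phi> \<in> Aut R F M" "subfield M R" "F \<subseteq> M" "set p \<subseteq> F" "x \<in> M"
  shows "\<phi> (eval p x) = eval p (\<phi> x)"
  using hom_eval[OF Aut_hom_R[OF assms(1,2)] assms(2) Aut_hom(4)[OF assms(1)] assms(3-5)] .

lemma Aut_antimono: "F \<subseteq> F' \<Longrightarrow> Aut R F' M \<subseteq> Aut R F M"
  unfolding Aut_def by auto

lemma Aut_conjugate:
  assumes "\<phi> \<in> Aut R F M" "intermediate F" "subfield M R" "F \<subseteq> M" "x \<in> M"
  shows "\<phi> x \<in> conjugates F x"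
proof -
  have x: "x \<in> carrier R" using assms(3,5) subfieldE(3) by blast
  have "eval (Irr F x) (\<phi> x) = \<phi> (eval (Irr F x) x)"
    using Aut_eval[OF assms(1,3,4) _ assms(5)] Irr_props(4)[OF assms(2) x] by simp
  also have "\<dots> = \<zero>" unfolding Irr_props(5)[OF assms(2) x]
    using Aut_hom(4)[OF assms(1)] subringE(2)[OF subfieldE(1)[OF conjunct1[OF assms(2)]]] by blast
  finally show ?thesis
    using Aut_hom(5)[OF assms(1,5)] subfieldE(3)[OF assms(3)] unfolding conjugates_def by auto
qed

text \<open>An embedding of an algebraic extension into itself permutes the finitely many conjugates of
  each element, hence it is onto.\<close>

lemma hom_image_eq:
  assumes h: "h \<in> ring_hom (R\<lparr>carrier := M\<rparr>) R" and M: "subfield M R" and F: "intermediate F" "F \<subseteq> M"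
    and fx: "\<And>a. a \<in> F \<Longrightarrow> h a = a" and into: "h ` M \<subseteq> M"
  shows "bij_betw h M M"
proof -
  have MR: "M \<subseteq> carrier R" using subfieldE(3)[OF M] .
  interpret h: ring_hom_ring "R\<lparr>carrier := M\<rparr>" R h
    using ring_hom_ringI2[OF _ ring_axioms h] subring_is_ring[OF subfieldE(1)[OF M]] by blast
  interpret M: field "R\<lparr>carrier := M\<rparr>" using subfield_iff(2)[OF M] .
  have inj: "inj_on h M" using h.img_is_subfield(1)[OF M.carrier_is_subfield] by simp
  have "x \<in> h ` M" if x: "x \<in> M" for x
  proof -
    have xR: "x \<in> carrier R" using x MR by auto
    let ?C = "conjugates F x \<inter> M"
    have "h ` ?C \<subseteq> ?C"
    proof
      fix z assume "z \<in> h ` ?C"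
      then obtain y where y: "y \<in> conjugates F x" "y \<in> M" "z = h y" by auto
      have "eval (Irr F x) z = h (eval (Irr F x) y)"
        unfolding y(3) using hom_eval[OF h M fx F(2) _ y(2)] Irr_props(4)[OF F(1) xR] by simp
      also have "\<dots> = h \<zero>" using y(1) unfolding conjugates_def by simp
      also have "\<dots> = \<zero>" using h.hom_zero by simp
      finally show "z \<in> ?C" using y into MR unfolding conjugates_def by auto
    qed
    then have "h ` ?C = ?C"
      using endo_inj_surj[of ?C h] card_conjugates(1)[OF F(1) xR] inj_on_subset[OF inj] by auto
    then show ?thesis using self_conjugate[OF F(1) xR] x by blast
  qed
  then show ?thesis using inj into unfolding bij_betw_def by blast
qed

text \<open>Surjectivity comes from the finiteness of sets of conjugates; \<open>restrict\<close>
  supplies the extensionality that \<open>Aut\<close> demands, so that automorphisms are determined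
  by their values on \<open>M\<close>.\<close>

lemma AutI:
  assumes h: "h \<in> ring_hom (R\<lparr>carrier := M\<rparr>) R" and M: "subfield M R" and F: "intermediate F" "F \<subseteq> M"
    and fx: "\<And>a. a \<in> F \<Longrightarrow> h a = a" and into: "h ` M \<subseteq> M"
  shows "restrict h M \<in> Aut R F M"
proof -
  have b: "bij_betw (restrict h M) M M"
    using hom_image_eq[OF assms] by (simp add: bij_betw_restrict_eq)
  have o: "\<one> \<in> M" and cl: "\<And>x y. x \<in> M \<Longrightarrow> y \<in> M \<Longrightarrow> x \<otimes> y \<in> M" "\<And>x y. x \<in> M \<Longrightarrow> y \<in> M \<Longrightarrow> x \<oplus> y \<in> M"
    using subringE(3,6,7)[OF subfieldE(1)[OF M]] by auto
  have "restrict h M \<in> ring_hom (R\<lparr>carrier := M\<rparr>) (R\<lparr>carrier := M\<rparr>)"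
    using ring_hom_memE[OF h] o cl into by (intro ring_hom_memI) auto
  then show ?thesis
    using b fx F(2) unfolding Aut_def ring_iso_def by auto
qed

lemma Gal_simps [simp]: "carrier (Gal R F M) = Aut R F M" "\<one>\<^bsub>Gal R F M\<^esub> = restrict id M"
  "x \<in> M \<Longrightarrow> (\<phi> \<otimes>\<^bsub>Gal R F M\<^esub> \<psi>) x = \<phi> (\<psi> x)"
  unfolding Gal_def by auto

lemma ring_hom_restrict:
  assumes "h \<in> ring_hom (R\<lparr>carrier := M\<rparr>) (R\<lparr>carrier := M\<rparr>)" "subfield M R"
  shows "restrict h M \<in> ring_hom (R\<lparr>carrier := M\<rparr>) (R\<lparr>carrier := M\<rparr>)"
  using ring_hom_memE[OF assms(1)] subringE(3,6,7)[OF subfieldE(1)[OF assms(2)]]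
  by (intro ring_hom_memI) auto

lemma group_Gal:
  assumes M: "subfield M R" and F: "F \<subseteq> M"
  shows "group (Gal R F M)"
proof (rule groupI)
  interpret M: ring "R\<lparr>carrier := M\<rparr>" using subring_is_ring[OF subfieldE(1)[OF M]] .
  have closed: "restrict (\<phi> \<circ> \<psi>) M \<in> Aut R F M" if s: "\<phi> \<in> Aut R F M" and t: "\<psi> \<in> Aut R F M" for \<phi> \<psi>
  proof -
    have "\<phi> \<circ> \<psi> \<in> ring_hom (R\<lparr>carrier := M\<rparr>) (R\<lparr>carrier := M\<rparr>)"
      using ring_hom_trans[OF Aut_hom(1)[OF t] Aut_hom(1)[OF s]] .
    moreover have "bij_betw (\<phi> \<circ> \<psi>) M M" using bij_betw_trans[OF Aut_hom(2)[OF t] Aut_hom(2)[OF s]] .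
    moreover have "(\<phi> \<circ> \<psi>) x = x" if "x \<in> F" for x using that Aut_hom(4)[OF s] Aut_hom(4)[OF t] by simp
    ultimately show ?thesis
      using ring_hom_restrict[OF _ M] F unfolding Aut_def ring_iso_def
      by (auto simp: bij_betw_restrict_eq)
  qed
  show "\<phi> \<otimes>\<^bsub>Gal R F M\<^esub> \<psi> \<in> carrier (Gal R F M)"
    if "\<phi> \<in> carrier (Gal R F M)" "\<psi> \<in> carrier (Gal R F M)" for \<phi> \<psi>
    using closed that unfolding Gal_def by simp
  have "id \<in> ring_hom (R\<lparr>carrier := M\<rparr>) (R\<lparr>carrier := M\<rparr>)" by (rule ring_hom_memI) auto
  then show "\<one>\<^bsub>Gal R F M\<^esub> \<in> carrier (Gal R F M)"
    using ring_hom_restrict[OF _ M] F unfolding Gal_simps Aut_def ring_iso_def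
    by (auto simp: bij_betw_restrict_eq bij_betw_def)
  have ext: "\<phi> = \<psi>" if "\<phi> \<in> extensional M" "\<psi> \<in> extensional M" "\<And>x. x \<in> M \<Longrightarrow> \<phi> x = \<psi> x" for \<phi> \<psi>
    using extensionalityI that by metis
  have me: "\<phi> \<otimes>\<^bsub>Gal R F M\<^esub> \<psi> \<in> extensional M" for \<phi> \<psi> unfolding Gal_def by simp
  show "\<phi> \<otimes>\<^bsub>Gal R F M\<^esub> \<psi> \<otimes>\<^bsub>Gal R F M\<^esub> \<chi> = \<phi> \<otimes>\<^bsub>Gal R F M\<^esub> (\<psi> \<otimes>\<^bsub>Gal R F M\<^esub> \<chi>)"
    if "\<phi> \<in> carrier (Gal R F M)" "\<psi> \<in> carrier (Gal R F M)" "\<chi> \<in> carrier (Gal R F M)" for \<phi> \<psi> \<chi>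
    using that Aut_hom(5) by (intro ext[OF me me]) simp
  show "\<one>\<^bsub>Gal R F M\<^esub> \<otimes>\<^bsub>Gal R F M\<^esub> \<phi> = \<phi>" if "\<phi> \<in> carrier (Gal R F M)" for \<phi>
    using that Aut_hom(3,5) by (intro ext[OF me]) auto
  show "\<exists>\<psi>\<in>carrier (Gal R F M). \<psi> \<otimes>\<^bsub>Gal R F M\<^esub> \<phi> = \<one>\<^bsub>Gal R F M\<^esub>" if s: "\<phi> \<in> carrier (Gal R F M)" for \<phi>
  proof -
    have s': "\<phi> \<in> Aut R F M" using s by simp
    note b = Aut_hom(2)[OF s']
    have "\<phi> \<in> ring_iso (R\<lparr>carrier := M\<rparr>) (R\<lparr>carrier := M\<rparr>)" using s' unfolding Aut_def by simp
    then have "inv_into M \<phi> \<in> ring_iso (R\<lparr>carrier := M\<rparr>) (R\<lparr>carrier := M\<rparr>)"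
      using ring_iso_set_sym[OF M.ring_axioms] by auto
    then have "restrict (inv_into M \<phi>) M \<in> Aut R F M"
      using ring_hom_restrict[OF _ M] F bij_betw_inv_into_left[OF b] Aut_hom(4)[OF s']
      unfolding Aut_def ring_iso_def by (auto simp: bij_betw_restrict_eq) (metis subsetD)
    moreover have "restrict (inv_into M \<phi>) M \<otimes>\<^bsub>Gal R F M\<^esub> \<phi> = \<one>\<^bsub>Gal R F M\<^esub>"
      using bij_betw_inv_into_left[OF b] Aut_hom(5)[OF s'] by (intro ext[OF me]) auto
    ultimately show ?thesis by auto
  qed
qed

lemma Gal_action:
  assumes M: "subfield M R" and F: "F \<subseteq> M"
  shows "group_action (Gal R F M) M (\<lambda>\<phi>. \<phi>)"
proof -
  have Bij: "\<phi> \<in> Bij M" if "\<phi> \<in> Aut R F M" for \<phi>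
    using Aut_hom(2,3)[OF that] unfolding Bij_def by simp
  have "(\<lambda>\<phi>. \<phi>) \<in> hom (Gal R F M) (BijGroup M)"
    using Bij unfolding hom_def BijGroup_def Gal_def by (auto simp: compose_def)
  then show ?thesis
    unfolding group_action_def group_hom_def group_hom_axioms_def
    using group_Gal[OF assms] group_BijGroup by blast
qed

lemma simple_extension_over:
  assumes "intermediate F" "F \<subseteq> M" "x \<in> carrier R" "simple_extension K x = M"
  shows "simple_extension F x = M"
proof
  have M: "intermediate M" "x \<in> M" using simple_extension_props[OF intermediate_base assms(3)] assms(4) by auto
  show "simple_extension F x \<subseteq> M" using simple_extension_least[OF _ assms(2) M(2)] M(1) by blast
  show "M \<subseteq> simple_extension F x" using mono_simple_extension[of K F x] assms(1,4) by blast
qed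

lemma simple_extension_eq_generate:
  "x \<in> carrier R \<Longrightarrow> generate_field R (insert x K) = simple_extension K x"
  using generate_field_insert[OF intermediate_base] .

text \<open>The definition selects a primitive element by \<open>SOME\<close>, which is meaningful
  by the primitive element theorem. Only the existence of some generator with this count is exposed;
  that the count is intrinsic shows later, when it becomes an index in a normalizer.\<close>

lemma cluster_sizeE:
  assumes "finite_ext R K M"
  obtains x where "x \<in> M" "simple_extension K x = M"
    "cluster_size R K M = card (conjugates K x \<inter> M)"
proof -
  have MR: "M \<subseteq> carrier R" using assms subfieldE(3) unfolding finite_ext_def by blast
  let ?P = "\<lambda>\<alpha>. \<alpha> \<in> M \<and> generate_field R (insert \<alpha> K) = M"
  have "\<exists>\<alpha>. ?P \<alpha>"
    using primitive_element[OF assms] simple_extension_eq_generate MR by blast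
  then have P: "?P (SOME \<alpha>. ?P \<alpha>)" by (rule someI_ex)
  have "{y \<in> M. eval (Irr K \<alpha>) y = \<zero>} = conjugates K \<alpha> \<inter> M" for \<alpha>
    unfolding conjugates_def using MR by auto
  then show thesis
    using P simple_extension_eq_generate[of "SOME \<alpha>. ?P \<alpha>"] MR
    by (intro that[of "SOME \<alpha>. ?P \<alpha>"]) (auto simp: cluster_size_def)
qed

text \<open>A primitive element of \<open>M\<close> over \<open>K\<close> also generates
  \<open>M\<close> over \<open>F\<close>, so \<open>M\<close> is finite over \<open>F\<close>, and
  \<open>F'\<close> is a subspace of \<open>M\<close>.\<close>

lemma finite_ext_tower:
  assumes M: "finite_ext R K M" and F: "intermediate F" "F \<subseteq> F'" "subfield F' R" "F' \<subseteq> M"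
  shows "finite_ext R F F'"
proof -
  obtain x where x: "x \<in> M" "simple_extension K x = M" using primitive_element[OF M] by blast
  have M': "subfield M R" using M unfolding finite_ext_def by simp
  have xR: "x \<in> carrier R" using x(1) subfieldE(3)[OF M'] by auto
  have "finite_dimension F M"
    using simple_extension_over[OF F(1) _ xR x(2)] F simple_extension_props(4)[OF F(1) xR] by auto
  moreover have "subalgebra F F' R"
    using subring.axioms(1)[OF subfieldE(1)[OF F(3)]] subringE(6)[OF subfieldE(1)[OF F(3)]] F(2)
    unfolding subalgebra_def subalgebra_axioms_def by blast
  ultimately have "finite_dimension F F'"
    using subalbegra_incl_imp_finite_dimension F(1,4) by blast
  then show ?thesis using F unfolding finite_ext_def by simp
qed

lemma dim_tower:
  assumes "finite_ext R K M" "intermediate F" "F \<subseteq> F'" "subfield F' R" "F' \<subseteq> M"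
  shows "dim F M = dim F F' * dim F' M"
proof -
  have M: "subfield M R" using assms(1) unfolding finite_ext_def by simp
  have F': "intermediate F'" using assms by auto
  have "finite_ext R F F'" "finite_ext R F' M"
    using finite_ext_tower[OF assms] finite_ext_tower[OF assms(1) F' assms(5) M] by auto
  then show ?thesis
    using telescopic_base_dim(2)[of F F' M] assms(2,4) unfolding finite_ext_def over_def by blast
qed

lemma dim_self: "subfield F R \<Longrightarrow> dim F F = 1"
  using dimI[OF _ dimension_one] unfolding over_def by blast

lemma monic_polynomial_with_roots:
  assumes "finite A" "A \<subseteq> M" "subfield M R"
  shows "\<exists>g. set g \<subseteq> M \<and> length g = Suc (card A) \<and> hd g = \<one> \<and> (\<forall>a\<in>A. eval g a = \<zero>)"
  using assms(1,2)
proof (induct A)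
  case empty
  then show ?case using subringE(3)[OF subfieldE(1)[OF assms(3)]] by (intro exI[of _ "[\<one>]"]) auto
next
  case (insert a A)
  note sub = subfieldE(1)[OF assms(3)]
  have MR: "M \<subseteq> carrier R" using subfieldE(3)[OF assms(3)] .
  obtain g where g: "set g \<subseteq> M" "length g = Suc (card A)" "hd g = \<one>" "\<forall>a\<in>A. eval g a = \<zero>"
    using insert by auto
  let ?l = "[\<one>, \<ominus> a]"
  have aM: "a \<in> M" "A \<subseteq> M" using insert by auto
  have l: "set ?l \<subseteq> M" "polynomial M ?l" and gp: "polynomial M g"
    using aM subringE(3,5)[OF sub] g unfolding polynomial_def by auto
  define f where "f = poly_mult ?l g"
  have fM: "set f \<subseteq> M"
    using polynomial_incl[OF poly_mult_is_polynomial[OF sub l(1) g(1)]] unfolding f_def .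
  have fd: "degree f = Suc (card A)"
    using poly_mult_degree_eq[OF sub l(2) gp] g(2) unfolding f_def by auto
  have fe: "eval f x = (x \<ominus> a) \<otimes> eval g x" if x: "x \<in> carrier R" for x
  proof -
    have "eval f x = eval ?l x \<otimes> eval g x"
      unfolding f_def by (rule eval_poly_mult) (use l(1) g(1) MR x in blast)+
    also have "eval ?l x = x \<ominus> a" using x aM MR by (auto simp: a_minus_def)
    finally show ?thesis .
  qed
  have "eval f b = \<zero>" if b: "b \<in> insert a A" for b
  proof -
    have bR: "b \<in> carrier R" using b aM MR by auto
    have gb: "eval g b \<in> carrier R" using eval_in_carrier[OF _ bR] g(1) MR by blast
    show ?thesis
    proof (cases "b = a")
      case True then show ?thesis using fe[OF bR] gb bR by (simp add: a_minus_def r_neg)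
    next
      case False
      then have "eval g b = \<zero>" using b g(4) by auto
      then show ?thesis using fe[OF bR] bR aM MR by (simp add: subsetD)
    qed
  qed
  moreover have "hd f = \<one>"
  proof -
    have "g \<noteq> []" using g(2) by auto
    then have "hd f = hd ?l \<otimes> hd g"
      using poly_mult_lead_coeff[OF sub l(2) gp] unfolding f_def by blast
    then show ?thesis using g(3) by simp
  qed
  moreover have "length f = Suc (card (insert a A))"
    using fd insert(1,2) by (cases f) auto
  ultimately show ?case using fM by blast
qed

text \<open>The difference has degree below \<open>card A\<close> but vanishes on all of
  \<open>A\<close>. As both lists have the same length, equal coefficients make them equal as
  lists.\<close>

lemma polynomials_eq_if_agree:
  assumes A: "finite A" "A \<subseteq> carrier R" and u: "set u \<subseteq> carrier R" "length u = card A"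
    and v: "set v \<subseteq> carrier R" "length v = card A" and eq: "\<And>a. a \<in> A \<Longrightarrow> eval u a = eval v a"
  shows "u = v"
proof -
  let ?w = "map ((\<otimes>) (\<ominus> \<one>)) v"
  have w: "set ?w \<subseteq> carrier R" using v by auto
  define d where "d = poly_add u ?w"
  have dp: "d \<in> carrier (poly_ring R)"
    using poly_add_is_polynomial[OF carrier_is_subring u(1) w] unfolding d_def univ_poly_carrier .
  have ld: "length d \<le> card A" using poly_add_length_le[of u ?w] u v unfolding d_def by simp
  have de: "eval d a = \<zero>" if a: "a \<in> A" for a
  proof -
    have aR: "a \<in> carrier R" using a A by auto
    have "eval d a = eval u a \<oplus> (\<ominus> \<one>) \<otimes> eval v a"
      unfolding d_def using eval_poly_add[OF u(1) w aR] eval_map_smult[OF v(1) _ aR] by simp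
    also have "\<dots> = \<zero>" unfolding eq[OF a] using eval_in_carrier[OF v(1) aR] by algebra
    finally show ?thesis .
  qed
  have "d = []"
  proof (rule ccontr)
    assume ne: "d \<noteq> []"
    have "A \<subseteq> set_mset (roots d)"
      using roots_mem_iff_is_root[OF dp] de ne A unfolding is_root_def by auto
    then have "card A \<le> card (set_mset (roots d))" by (intro card_mono) auto
    also have "\<dots> \<le> size (roots d)" by (metis mset_set_set_mset_msubset size_mset_mono size_mset_set)
    also have "\<dots> \<le> degree d" using size_roots_le_degree[OF dp] .
    finally show False using ld ne by (cases d) auto
  qed
  then have z: "coeff u i \<oplus> coeff ?w i = \<zero>" for i
  proof -
    have "coeff d i = coeff u i \<oplus> coeff ?w i"
      unfolding d_def poly_add_coeff[OF u(1) w] ..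
    then show ?thesis using \<open>d = []\<close> by simp
  qed
  have "coeff u i = coeff v i" for i
  proof -
    have c: "coeff u i \<in> carrier R" "coeff v i \<in> carrier R" using u v by auto
    have "coeff ?w i = (\<ominus> \<one>) \<otimes> coeff v i" by (simp add: scalar_coeff)
    then have "coeff u i \<ominus> coeff v i = \<zero>" using z[of i] c by (simp add: l_minus a_minus_def)
    then show ?thesis using c r_right_minus_eq by blast
  qed
  then have "coeff u = coeff v" by blast
  then show ?thesis using coeff_iff_length_cond[of u v] u(2) v(2) by simp
qed

end

text \<open>\<open>normalizer\<close> is a stabilizer of the set \<open>H\<close>, so it asks for
  equality of \<open>H\<close> with its conjugate. Conjugation is injective, so for finite
  \<open>H\<close> one inclusion is enough, and that inclusion is what translates into a condition
  on fields.\<close>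

lemma (in group) normalizer_eq_conjugation:
  assumes H: "subgroup H G" and fin: "finite H"
  shows "normalizer G H = {g \<in> carrier G. \<forall>h\<in>H. inv g \<otimes> h \<otimes> g \<in> H}"
proof -
  have HG: "H \<subseteq> carrier G" using subgroup.subset[OF H] .
  have coset: "g <# H #> inv g = (\<lambda>h. g \<otimes> h \<otimes> inv g) ` H" for g
    unfolding l_coset_def r_coset_def by auto
  have *: "(g <# H #> inv g = H) \<longleftrightarrow> (\<forall>h\<in>H. inv g \<otimes> h \<otimes> g \<in> H)" if g: "g \<in> carrier G" for g
  proof
    assume eq: "g <# H #> inv g = H"
    show "\<forall>h\<in>H. inv g \<otimes> h \<otimes> g \<in> H"
    proof
      fix h assume "h \<in> H"
      then have "h \<in> (\<lambda>h. g \<otimes> h \<otimes> inv g) ` H" unfolding coset[symmetric] eq .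
      then obtain k where k: "k \<in> H" "h = g \<otimes> k \<otimes> inv g" by (rule imageE)
      have kG: "k \<in> carrier G" using k(1) HG by (rule rev_subsetD)
      have "inv g \<otimes> h \<otimes> g = k"
        unfolding k(2) using conjugation_is_surj[OF inv_closed[OF g] kG] unfolding inv_inv[OF g] .
      then show "inv g \<otimes> h \<otimes> g \<in> H" using k(1) by simp
    qed
  next
    assume a: "\<forall>h\<in>H. inv g \<otimes> h \<otimes> g \<in> H"
    have inv_conj: "g \<otimes> (inv g \<otimes> h \<otimes> g) \<otimes> inv g = h" if "h \<in> H" for h
      by (rule conjugation_is_surj[OF g]) (rule rev_subsetD[OF that HG])
    have inj: "inj_on (\<lambda>h. inv g \<otimes> h \<otimes> g) H"
      by (rule inj_on_inverseI[where g = "\<lambda>h. g \<otimes> h \<otimes> inv g"]) (rule inv_conj)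
    have "(\<lambda>h. inv g \<otimes> h \<otimes> g) ` H = H"
      by (rule endo_inj_surj[OF fin _ inj]) (use a in blast)
    then have "g <# H #> inv g = (\<lambda>h. g \<otimes> h \<otimes> inv g) ` (\<lambda>h. inv g \<otimes> h \<otimes> g) ` H"
      unfolding coset by (rule arg_cong[OF sym])
    also have "\<dots> = (\<lambda>h. h) ` H" unfolding image_image by (rule image_cong[OF refl inv_conj])
    finally show "g <# H #> inv g = H" by simp
  qed
  have "normalizer G H = {g \<in> carrier G. g <# H #> inv g = H}"
    unfolding normalizer_def stabilizer_def using HG by simp
  then show ?thesis using * by blast
qed

section \<open>The Galois correspondence\<close>

text \<open>Being Galois is encoded by a condition on a single generator. This is easy to verify for
  a concrete field, and \<open>E_galois\<close> derives normality of the whole of \<open>E\<close>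
  from it.\<close>

locale galois_setting = perfect_closure R K for R :: "'a ring" (structure) and K +
  fixes E :: "'a set" and \<theta> :: 'a
  assumes theta_carrier: "\<theta> \<in> carrier R"
    and E_def: "simple_extension K \<theta> = E"
    and conjugates_theta: "conjugates K \<theta> \<subseteq> E"
begin

abbreviation sub_extension :: "'a set \<Rightarrow> bool" where
  "sub_extension F \<equiv> intermediate F \<and> F \<subseteq> E"

abbreviation G :: "('a \<Rightarrow> 'a) monoid" where "G \<equiv> Gal R K E"

lemma E_subfield: "subfield E R" and base_sub: "sub_extension K" and theta_mem: "\<theta> \<in> E"
  and E_carrier: "E \<subseteq> carrier R"
  using simple_extension_props[OF intermediate_base theta_carrier] intermediate_base subfieldE(3)
  unfolding E_def by auto

lemma E_over: "sub_extension F \<Longrightarrow> simple_extension F \<theta> = E"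
  using simple_extension_over[OF _ _ theta_carrier E_def] by blast

lemma E_finite: "finite_ext R K E"
  using simple_extension_props(4)[OF intermediate_base theta_carrier] E_subfield base_sub
  unfolding finite_ext_def E_def by simp

lemma finite_ext_sub:
  assumes "sub_extension F" "sub_extension F'" "F \<subseteq> F'"
  shows "finite_ext R F F'"
  using finite_ext_tower[OF E_finite, of F F'] assms by blast

lemma dim_E_pos: "sub_extension F \<Longrightarrow> dim F E > 0"
  using simple_extension_props(5)[of F \<theta>] Irr_props(7)[of F \<theta>] theta_carrier E_over by fastforce

lemma dim_sub_tower:
  assumes "sub_extension F" "sub_extension F'" "F \<subseteq> F'"
  shows "dim F E = dim F F' * dim F' E"
  using dim_tower[OF E_finite] assms by blast

text \<open>An automorphism is determined by the image of the generator. Conversely, every conjugate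
  \<open>y\<close> of \<open>\<theta>\<close> lies in \<open>E\<close>, so the embedding that sends
  \<open>\<theta>\<close> to \<open>y\<close> maps \<open>E\<close> into itself.\<close>

lemma Aut_theta_bij:
  assumes F: "sub_extension F"
  shows "bij_betw (\<lambda>\<phi>. \<phi> \<theta>) (Aut R F E) (conjugates F \<theta>)"
  unfolding bij_betw_def
proof
  have FI: "intermediate F" "F \<subseteq> E" using F by auto
  show "inj_on (\<lambda>\<phi>. \<phi> \<theta>) (Aut R F E)"
  proof (rule inj_onI)
    fix \<phi> \<psi> assume s: "\<phi> \<in> Aut R F E" and t: "\<psi> \<in> Aut R F E" and eq: "\<phi> \<theta> = \<psi> \<theta>"
    show "\<phi> = \<psi>"
    proof (rule extensionalityI[OF Aut_hom(3)[OF s] Aut_hom(3)[OF t]])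
      fix z assume "z \<in> E"
      then show "\<phi> z = \<psi> z"
        using hom_simple_extension_cong[OF FI(1) theta_carrier, unfolded E_over[OF F],
            OF Aut_hom_R[OF s E_subfield] Aut_hom(4)[OF s] Aut_hom_R[OF t E_subfield] Aut_hom(4)[OF t] eq]
        by blast
    qed
  qed
  show "(\<lambda>\<phi>. \<phi> \<theta>) ` Aut R F E = conjugates F \<theta>"
  proof
    show "(\<lambda>\<phi>. \<phi> \<theta>) ` Aut R F E \<subseteq> conjugates F \<theta>"
      using Aut_conjugate[OF _ FI(1) E_subfield FI(2) theta_mem] by blast
    show "conjugates F \<theta> \<subseteq> (\<lambda>\<phi>. \<phi> \<theta>) ` Aut R F E"
    proof
      fix y assume y: "y \<in> conjugates F \<theta>"
      then have yE: "y \<in> E"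
        using conjugates_mono[OF intermediate_base FI(1) _ theta_carrier] FI conjugates_theta by blast
      obtain h where h: "h \<in> ring_hom (R\<lparr>carrier := E\<rparr>) R" "\<forall>a\<in>F. h a = a" "h \<theta> = y"
        using conjugate_hom[OF FI(1) theta_carrier y] unfolding E_over[OF F] by blast
      have "h ` E \<subseteq> E"
      proof
        fix w assume "w \<in> h ` E"
        then obtain z where z: "z \<in> E" "w = h z" by blast
        then obtain p where p: "set p \<subseteq> F" "z = eval p \<theta>"
          using simple_extensionE[OF FI(1) theta_carrier, unfolded E_over[OF F]] by metis
        have "w = eval p y"
          using hom_eval[OF h(1) E_subfield _ FI(2) p(1) theta_mem] h(2,3) z(2) p(2) by simp
        then show "w \<in> E" using eval_in_subfield[OF E_subfield _ yE] p(1) FI(2) by blast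
      qed
      then have "restrict h E \<in> Aut R F E" using AutI[OF h(1) E_subfield FI] h(2) by blast
      moreover have "restrict h E \<theta> = y" using theta_mem h(3) by simp
      ultimately show "y \<in> (\<lambda>\<phi>. \<phi> \<theta>) ` Aut R F E" by blast
    qed
  qed
qed

lemma card_Aut:
  assumes F: "sub_extension F"
  shows "finite (Aut R F E)" "card (Aut R F E) = dim F E"
proof -
  have c: "finite (conjugates F \<theta>)" "card (conjugates F \<theta>) = degree (Irr F \<theta>)"
    using card_conjugates theta_carrier F by blast+
  show "finite (Aut R F E)" using bij_betw_finite[OF Aut_theta_bij[OF F]] c(1) by simp
  show "card (Aut R F E) = dim F E"
    using bij_betw_same_card[OF Aut_theta_bij[OF F]] c(2) simple_extension_props(5)[of F \<theta>] F theta_carrier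
    by (simp add: E_over[OF F])
qed

lemma group_G: "group (Gal R F E)" if "sub_extension F" for F
  using group_Gal[OF E_subfield] that by blast

lemma Aut_subgroup:
  assumes "sub_extension F"
  shows "subgroup (Aut R F E) G"
proof -
  interpret G: group G using group_G[OF base_sub] .
  interpret GF: group "Gal R F E" using group_G[OF assms] .
  have sub: "Aut R F E \<subseteq> carrier G" using Aut_antimono assms by simp
  show ?thesis
  proof (rule G.subgroupI[OF sub])
    show "Aut R F E \<noteq> {}" using GF.one_closed by auto
    fix \<phi> assume s: "\<phi> \<in> Aut R F E"
    have eq: "inv\<^bsub>Gal R F E\<^esub> \<phi> \<otimes>\<^bsub>G\<^esub> \<phi> = \<one>\<^bsub>G\<^esub>"
      using GF.l_inv[of \<phi>] s unfolding Gal_def by simp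
    have mem: "inv\<^bsub>Gal R F E\<^esub> \<phi> \<in> Aut R F E" using GF.inv_closed[of \<phi>] s by simp
    have "inv\<^bsub>G\<^esub> \<phi> = inv\<^bsub>Gal R F E\<^esub> \<phi>"
      by (rule G.inv_equality[OF eq]) (use s mem sub in auto)
    then show "inv\<^bsub>G\<^esub> \<phi> \<in> Aut R F E" using mem by simp
    fix \<psi> assume t: "\<psi> \<in> Aut R F E"
    show "\<phi> \<otimes>\<^bsub>G\<^esub> \<psi> \<in> Aut R F E"
      using GF.m_closed[of \<phi> \<psi>] s t unfolding Gal_def by simp
  qed
qed

lemma Aut_transitive:
  assumes F: "sub_extension F" and x: "x \<in> E" and y: "y \<in> conjugates F x"
  shows "\<exists>\<phi>\<in>Aut R F E. \<phi> x = y"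
proof -
  have FI: "intermediate F" "F \<subseteq> E" using F by auto
  have xR: "x \<in> carrier R" using x E_carrier by auto
  let ?F = "simple_extension F x"
  note P = simple_extension_props[OF FI(1) xR]
  have F': "sub_extension ?F" using P(1) simple_extension_least[OF E_subfield FI(2) x] by simp
  interpret A: group_action "Gal R F E" E "\<lambda>\<phi>. \<phi>" using Gal_action[OF E_subfield FI(2)] .
  have orb: "orbit (Gal R F E) (\<lambda>\<phi>. \<phi>) x = (\<lambda>\<phi>. \<phi> x) ` Aut R F E"
    unfolding orbit_def by auto
  have "stabilizer (Gal R F E) (\<lambda>\<phi>. \<phi>) x = Aut R ?F E"
  proof
    show "stabilizer (Gal R F E) (\<lambda>\<phi>. \<phi>) x \<subseteq> Aut R ?F E"
    proof
      fix \<phi> assume "\<phi> \<in> stabilizer (Gal R F E) (\<lambda>\<phi>. \<phi>) x"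
      then have s: "\<phi> \<in> Aut R F E" "\<phi> x = x" unfolding stabilizer_def by auto
      have "\<phi> z = z" if "z \<in> ?F" for z
      proof -
        obtain p where p: "set p \<subseteq> F" "z = eval p x" using simple_extensionE[OF FI(1) xR \<open>z \<in> ?F\<close>] by blast
        then show ?thesis using Aut_eval[OF s(1) E_subfield FI(2) p(1) x] s(2) by simp
      qed
      then show "\<phi> \<in> Aut R ?F E" using s(1) unfolding Aut_def by simp
    qed
    show "Aut R ?F E \<subseteq> stabilizer (Gal R F E) (\<lambda>\<phi>. \<phi>) x"
      using Aut_antimono[OF P(2)] Aut_hom(4)[OF _ P(3)] unfolding stabilizer_def by auto
  qed
  \<comment> \<open>Orbit times stabilizer, with both group orders read as degrees. The tower
    formula through \<open>F(x)\<close> then shows that the orbit has \<open>[F(x) : F]\<close>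
    elements, the number of conjugates of \<open>x\<close>.\<close>
  then have "card ((\<lambda>\<phi>. \<phi> x) ` Aut R F E) * dim ?F E = dim F E"
    using A.orbit_stabilizer_theorem[OF x] card_Aut(2)[OF F] card_Aut(2)[OF F']
    unfolding orb order_def by simp
  also have "\<dots> = card (conjugates F x) * dim ?F E"
    using dim_sub_tower[OF F F' P(2)] P(5) card_conjugates(2)[OF FI(1) xR] by simp
  finally have "card ((\<lambda>\<phi>. \<phi> x) ` Aut R F E) = card (conjugates F x)"
    using dim_E_pos[OF F'] by simp
  moreover have "(\<lambda>\<phi>. \<phi> x) ` Aut R F E \<subseteq> conjugates F x"
    using Aut_conjugate[OF _ FI(1) E_subfield FI(2) x] by blast
  ultimately have "(\<lambda>\<phi>. \<phi> x) ` Aut R F E = conjugates F x"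
    using card_subset_eq[OF card_conjugates(1)[OF FI(1) xR]] by blast
  then have "y \<in> (\<lambda>\<phi>. \<phi> x) ` Aut R F E" using y by simp
  then show ?thesis by blast
qed

lemma E_galois: "galois_ext R K E"
proof (rule galois_extI[OF intermediate_base E_finite])
  fix x assume x: "x \<in> E"
  show "conjugates K x \<subseteq> E"
    using Aut_transitive[OF base_sub x] Aut_hom(5)[OF _ x] by blast
qed

text \<open>By transitivity an element fixed by the whole group has no conjugate over
  \<open>F\<close> besides itself, and by separability it then lies in \<open>F\<close>.\<close>

lemma fixed_field_Aut:
  assumes F: "sub_extension F"
  shows "fixed_field E (Aut R F E) = F"
proof
  show "F \<subseteq> fixed_field E (Aut R F E)" using F Aut_hom(4) unfolding fixed_field_def by blast
  show "fixed_field E (Aut R F E) \<subseteq> F"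
  proof
    fix x assume "x \<in> fixed_field E (Aut R F E)"
    then have x: "x \<in> E" "\<And>\<phi>. \<phi> \<in> Aut R F E \<Longrightarrow> \<phi> x = x" unfolding fixed_field_def by auto
    have "conjugates F x \<subseteq> {x}" using Aut_transitive[OF F x(1)] x(2) by fastforce
    then show "x \<in> F" using memI_conjugates F x(1) E_carrier by blast
  qed
qed

lemma fixed_field_sub_extension:
  assumes "S \<subseteq> Aut R K E"
  shows "sub_extension (fixed_field E S)"
proof -
  note Er = subringE[OF subfieldE(1)[OF E_subfield]]
  let ?F = "fixed_field E S"
  interpret E: field "R\<lparr>carrier := E\<rparr>" using subfield_iff(2)[OF E_subfield] .
  have fixes_ops: "\<phi> \<one> = \<one>" "\<And>a b. a \<in> E \<Longrightarrow> b \<in> E \<Longrightarrow> \<phi> (a \<otimes> b) = \<phi> a \<otimes> \<phi> b"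
    "\<And>a b. a \<in> E \<Longrightarrow> b \<in> E \<Longrightarrow> \<phi> (a \<oplus> b) = \<phi> a \<oplus> \<phi> b" if "\<phi> \<in> S" for \<phi>
    using ring_hom_memE[OF Aut_hom_R[OF _ E_subfield], of \<phi>] that assms by auto
  have hom: "ring_hom_ring (R\<lparr>carrier := E\<rparr>) R \<phi>" if "\<phi> \<in> S" for \<phi>
    using ring_hom_ringI2[OF E.ring_axioms ring_axioms Aut_hom_R[OF _ E_subfield]] that assms by blast
  have "subfield ?F R"
  proof (rule subfieldI')
    show "subring ?F R"
    proof (rule subringI)
      show "?F \<subseteq> carrier R" using E_carrier unfolding fixed_field_def by auto
      show "\<one> \<in> ?F"
        using Er(3) fixes_ops(1) unfolding fixed_field_def by simp
      fix a assume a: "a \<in> ?F"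
      then have aE: "a \<in> E" "\<And>\<phi>. \<phi> \<in> S \<Longrightarrow> \<phi> a = a" unfolding fixed_field_def by auto
      have "\<phi> (\<ominus> a) = \<ominus> a" if s: "\<phi> \<in> S" for \<phi>
      proof -
        interpret h: ring_hom_ring "R\<lparr>carrier := E\<rparr>" R \<phi> using hom[OF s] .
        have aR: "a \<in> carrier R" and mE: "\<ominus> a \<in> E" using aE(1) E_carrier Er(5) by auto
        have c: "\<phi> (\<ominus> a) \<in> carrier R" using h.hom_closed mE by simp
        have "\<phi> (\<ominus> a) \<oplus> a = \<phi> (\<ominus> a \<oplus> a)" using fixes_ops(3)[OF s mE aE(1)] aE(2)[OF s] by simp
        also have "\<dots> = \<zero>" using h.hom_zero aR by (simp add: l_neg)
        finally show ?thesis using minus_equality[OF _ aR c] by simp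
      qed
      then show "\<ominus> a \<in> ?F" using Er(5) aE(1) unfolding fixed_field_def by simp
      fix b assume "b \<in> ?F"
      then have bE: "b \<in> E" "\<And>\<phi>. \<phi> \<in> S \<Longrightarrow> \<phi> b = b" unfolding fixed_field_def by auto
      show "a \<otimes> b \<in> ?F"
      proof -
        have "\<phi> (a \<otimes> b) = a \<otimes> b" if "\<phi> \<in> S" for \<phi>
          using fixes_ops(2)[OF that aE(1) bE(1)] aE(2)[OF that] bE(2)[OF that] by simp
        then show ?thesis using Er(6)[OF aE(1) bE(1)] unfolding fixed_field_def by blast
      qed
      show "a \<oplus> b \<in> ?F"
      proof -
        have "\<phi> (a \<oplus> b) = a \<oplus> b" if "\<phi> \<in> S" for \<phi>
          using fixes_ops(3)[OF that aE(1) bE(1)] aE(2)[OF that] bE(2)[OF that] by simp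
        then show ?thesis using Er(7)[OF aE(1) bE(1)] unfolding fixed_field_def by blast
      qed
    qed
    fix a assume a: "a \<in> ?F - {\<zero>}"
    then have aE: "a \<in> E" "a \<noteq> \<zero>" "a \<in> carrier R" "\<And>\<phi>. \<phi> \<in> S \<Longrightarrow> \<phi> a = a"
      using E_carrier unfolding fixed_field_def by auto
    have iE: "inv a \<in> E" "inv a \<in> carrier R" "a \<otimes> inv a = \<one>" "inv a \<otimes> a = \<one>"
      using subfield_m_inv[OF E_subfield, of a] aE(1,2) E_carrier by auto
    have "\<phi> (inv a) = inv a" if s: "\<phi> \<in> S" for \<phi>
    proof -
      interpret h: ring_hom_ring "R\<lparr>carrier := E\<rparr>" R \<phi> using hom[OF s] .
      have c: "\<phi> (inv a) \<in> carrier R" using h.hom_closed iE by simp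
      have "\<phi> (a \<otimes> inv a) = a \<otimes> \<phi> (inv a)" using fixes_ops(2)[OF s aE(1) iE(1)] aE(4)[OF s] by simp
      then have "a \<otimes> \<phi> (inv a) = \<one>" unfolding iE(3) using h.hom_one by simp
      then show ?thesis using inv_unique[OF iE(4) _ aE(3) iE(2) c] by simp
    qed
    then show "inv a \<in> ?F" using iE unfolding fixed_field_def by simp
  qed
  moreover have "K \<subseteq> ?F"
  proof
    fix x assume x: "x \<in> K"
    then have "\<phi> x = x" if "\<phi> \<in> S" for \<phi> using Aut_hom(4)[of \<phi> K E x] assms that by blast
    then show "x \<in> ?F" using x base_sub unfolding fixed_field_def by blast
  qed
  moreover have "?F \<subseteq> E" unfolding fixed_field_def by auto
  ultimately show ?thesis by blast
qed

text \<open>Artin's theorem. The monic polynomial whose roots are the images of the primitive element under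
  the group is determined by these roots, so it is fixed by the group and its degree bounds the degree of
  the extension.\<close>

lemma Aut_fixed_field:
  assumes S: "subgroup S G"
  shows "Aut R (fixed_field E S) E = S"
proof -
  interpret G: group G using group_G[OF base_sub] .
  interpret S: subgroup S G using S .
  have SA: "S \<subseteq> Aut R K E" using S.subset by simp
  let ?F = "fixed_field E S"
  have F: "sub_extension ?F" using fixed_field_sub_extension[OF SA] .
  have incl: "S \<subseteq> Aut R ?F E" using SA unfolding Aut_def fixed_field_def by auto
  let ?A = "(\<lambda>\<phi>. \<phi> \<theta>) ` S"
  have finS: "finite S" using finite_subset[OF SA card_Aut(1)[OF base_sub]] .
  have "inj_on (\<lambda>\<phi>. \<phi> \<theta>) S"
    using inj_on_subset[OF _ SA] Aut_theta_bij[OF base_sub] unfolding bij_betw_def by blast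
  then have cA: "card ?A = card S" by (rule card_image)
  have AE: "?A \<subseteq> E" using Aut_hom(5)[OF _ theta_mem] SA by blast
  have finA: "finite ?A" using finS by simp
  obtain g where g: "set g \<subseteq> E" "length g = Suc (card S)" "hd g = \<one>" "\<forall>a\<in>?A. eval g a = \<zero>"
    using monic_polynomial_with_roots[OF finA AE E_subfield] cA by auto
  \<comment> \<open>Without the leading coefficient the list has exactly as many entries as there
    are roots, the length at which agreement on the roots forces equality.\<close>
  obtain u where u: "g = \<one> # u" "set u \<subseteq> E" "length u = card S"
    using g(1-3) by (cases g) auto
  have "map \<psi> u = u" if t: "\<psi> \<in> S" for \<psi>
  proof (rule polynomials_eq_if_agree[OF finA])
    have tA: "\<psi> \<in> Aut R K E" using t SA by blast
    interpret h: ring_hom_ring "R\<lparr>carrier := E\<rparr>" R \<psi>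
      using ring_hom_ringI2[OF _ ring_axioms Aut_hom_R[OF tA E_subfield]]
        subring_is_ring[OF subfieldE(1)[OF E_subfield]] by blast
    show "?A \<subseteq> carrier R" "set u \<subseteq> carrier R" using AE u(2) E_carrier by auto
    show mu: "set (map \<psi> u) \<subseteq> carrier R" using u(2) Aut_hom(5)[OF tA] E_carrier by auto
    show "length (map \<psi> u) = card ?A" "length u = card ?A" using u(3) cA by auto
    fix b assume b: "b \<in> ?A"
    then obtain \<phi> where s: "\<phi> \<in> S" "b = \<phi> \<theta>" by blast
    have bR: "b \<in> carrier R" using b AE E_carrier by blast
    \<comment> \<open>\<open>\<chi> \<theta>\<close> is the root that \<open>\<psi>\<close> carries
      to \<open>b\<close>; applying \<open>\<psi>\<close> to the vanishing of \<open>g\<close> there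
      shows that the transformed polynomial vanishes at \<open>b\<close>.\<close>
    define \<chi> where "\<chi> = inv\<^bsub>G\<^esub> \<psi> \<otimes>\<^bsub>G\<^esub> \<phi>"
    have r: "\<chi> \<in> S" unfolding \<chi>_def using t s(1) by simp
    have "\<psi> \<otimes>\<^bsub>G\<^esub> \<chi> = \<phi>" unfolding \<chi>_def using t s(1) S.subset
      by (simp add: subset_iff del: Gal_simps(2) flip: G.m_assoc)
    then have b_eq: "\<psi> (\<chi> \<theta>) = b" unfolding s(2) using theta_mem Gal_simps(3) by metis
    have rE: "\<chi> \<theta> \<in> E" using r AE by blast
    have "eval (map \<psi> g) b = \<psi> (eval g (\<chi> \<theta>))"
      using h.eval_hom'[of "\<chi> \<theta>" g] rE g(1) eval_consistent[OF subfieldE(1)[OF E_subfield]] b_eq by simp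
    also have "\<dots> = \<psi> \<zero>" using g(4) r by simp
    also have "\<dots> = \<zero>" using h.hom_zero by simp
    finally have "eval (map \<psi> g) b = eval g b" using bspec[OF g(4) b] by simp
    moreover have "\<psi> \<one> = \<one>" using h.hom_one by simp
    ultimately have "b [^] length u \<oplus> eval (map \<psi> u) b = b [^] length u \<oplus> eval u b"
      unfolding u(1) using bR by simp
    then show "eval (map \<psi> u) b = eval u b"
      using bR eval_in_carrier[OF mu bR] eval_in_carrier[OF _ bR, of u] u(2) E_carrier
      by (auto simp: add.l_cancel)
  qed
  then have "set u \<subseteq> ?F"
    unfolding fixed_field_def using u(2) map_eq_conv[of _ u "\<lambda>x. x"] by (simp add: subset_iff)
  then have gF: "set g \<subseteq> ?F"
    using u(1) subringE(3)[OF subfieldE(1)] F by auto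
  have "restrict id E \<in> S" using S.one_closed unfolding Gal_simps .
  then have "\<theta> \<in> ?A" using theta_mem by (intro image_eqI[of _ _ "restrict id E"]) auto
  then have "eval g \<theta> = \<zero>" using g(4) by blast
  moreover have "normalize g \<noteq> []" using u(1) by simp
  ultimately have "length (Irr ?F \<theta>) \<le> length g"
    using Irr_degree_le[OF _ theta_carrier gF] F by blast
  then have "degree (Irr ?F \<theta>) \<le> card S" using g(2) by simp
  then have "card (Aut R ?F E) \<le> card S"
    using card_Aut(2)[OF F] simple_extension_props(5)[of ?F \<theta>] F theta_carrier E_over[OF F] by simp
  then show ?thesis using card_seteq[OF card_Aut(1)[OF F] incl] by blast
qed

text \<open>The conjugate of \<open>h\<close> by \<open>s\<close> fixes \<open>F\<close> pointwise
  exactly when \<open>h\<close> fixes the image of \<open>F\<close> under \<open>s\<close>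
  pointwise. For all \<open>h\<close> in \<open>Aut R F E\<close> together, this places the image
  inside the fixed field of that group, which is \<open>F\<close>.\<close>

lemma normalizer_Aut:
  assumes F: "sub_extension F"
  shows "normalizer G (Aut R F E) = {\<phi> \<in> Aut R K E. \<phi> ` F \<subseteq> F}"
proof -
  interpret G: group G using group_G[OF base_sub] .
  let ?H = "Aut R F E"
  have HG: "?H \<subseteq> Aut R K E" using Aut_antimono F by blast
  have FE: "F \<subseteq> E" using F by simp
  have "(\<forall>h\<in>?H. inv\<^bsub>G\<^esub> s \<otimes>\<^bsub>G\<^esub> h \<otimes>\<^bsub>G\<^esub> s \<in> ?H) \<longleftrightarrow> s ` F \<subseteq> F" if s: "s \<in> Aut R K E" for s
  proof -
    let ?i = "inv\<^bsub>G\<^esub> s"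
    have i: "?i \<in> Aut R K E" using G.inv_closed[of s] s by simp
    have inv_s: "?i (s x) = x" and si: "s (?i x) = x" if "x \<in> E" for x
    proof -
      have "(?i \<otimes>\<^bsub>G\<^esub> s) x = x" "(s \<otimes>\<^bsub>G\<^esub> ?i) x = x"
        using G.l_inv[of s] G.r_inv[of s] s that by simp_all
      then show "?i (s x) = x" "s (?i x) = x" using that by simp_all
    qed
    have ev: "(?i \<otimes>\<^bsub>G\<^esub> h \<otimes>\<^bsub>G\<^esub> s) x = ?i (h (s x))" if "x \<in> E" for h x
      using that Aut_hom(5)[OF s] by simp
    have "?i \<otimes>\<^bsub>G\<^esub> h \<otimes>\<^bsub>G\<^esub> s \<in> ?H \<longleftrightarrow> (\<forall>x\<in>F. h (s x) = s x)" if h: "h \<in> ?H" for h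
    proof -
      have hG: "h \<in> Aut R K E" using h HG by blast
      have "?i \<otimes>\<^bsub>G\<^esub> h \<otimes>\<^bsub>G\<^esub> s \<in> Aut R K E" using G.m_closed i hG s by simp
      then have "?i \<otimes>\<^bsub>G\<^esub> h \<otimes>\<^bsub>G\<^esub> s \<in> ?H \<longleftrightarrow> (\<forall>x\<in>F. (?i \<otimes>\<^bsub>G\<^esub> h \<otimes>\<^bsub>G\<^esub> s) x = x)"
        unfolding Aut_def by auto
      also have "\<dots> \<longleftrightarrow> (\<forall>x\<in>F. ?i (h (s x)) = x)" using ev FE by (auto simp: subset_iff)
      also have "\<dots> \<longleftrightarrow> (\<forall>x\<in>F. h (s x) = s x)"
      proof (rule ball_cong[OF refl])
        fix x assume "x \<in> F"
        then have x: "x \<in> E" using FE by blast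
        have "h (s x) \<in> E" using Aut_hom(5)[OF hG Aut_hom(5)[OF s x]] .
        then show "(?i (h (s x)) = x) = (h (s x) = s x)" using inv_s[OF x] si[of "h (s x)"] by auto
      qed
      finally show ?thesis .
    qed
    then have "(\<forall>h\<in>?H. ?i \<otimes>\<^bsub>G\<^esub> h \<otimes>\<^bsub>G\<^esub> s \<in> ?H) \<longleftrightarrow> (\<forall>h\<in>?H. \<forall>x\<in>F. h (s x) = s x)" by blast
    also have "\<dots> \<longleftrightarrow> (\<forall>x\<in>F. s x \<in> fixed_field E ?H)"
      unfolding fixed_field_def using Aut_hom(5)[OF s] FE by blast
    finally show ?thesis unfolding fixed_field_Aut[OF F] by blast
  qed
  then show ?thesis
    unfolding G.normalizer_eq_conjugation[OF Aut_subgroup[OF F] card_Aut(1)[OF F]] by auto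
qed

lemma card_normalizer:
  assumes F: "sub_extension F"
  shows "card (normalizer G (Aut R F E)) = cluster_size R K F * card (Aut R F E)"
proof -
  interpret G: group G using group_G[OF base_sub] .
  let ?H = "Aut R F E" and ?N = "normalizer G (Aut R F E)"
  have FE: "F \<subseteq> E" using F by simp
  have fin: "finite_ext R K F" using finite_ext_sub[OF base_sub F] F by blast
  obtain a where a: "a \<in> F" "simple_extension K a = F" "cluster_size R K F = card (conjugates K a \<inter> F)"
    using cluster_sizeE[OF fin] .
  have aE: "a \<in> E" and aR: "a \<in> carrier R" using a(1) FE E_carrier by auto
  have NG: "?N \<subseteq> Aut R K E" unfolding normalizer_Aut[OF F] by blast
  have HN: "?H \<subseteq> ?N" unfolding normalizer_Aut[OF F]
    using Aut_antimono[of K F E] F Aut_hom(4)[of _ F E] by force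
  have subN: "subgroup ?N G" using G.normalizer_imp_subgroup Aut_antimono F by simp
  interpret A: group_action G E "\<lambda>\<phi>. \<phi>" using Gal_action[OF E_subfield] base_sub by blast
  interpret AN: group_action "G\<lparr>carrier := ?N\<rparr>" E "\<lambda>\<phi>. \<phi>" using A.induced_action[OF subN] .
  \<comment> \<open>\<open>F\<close> consists of polynomial expressions in \<open>a\<close> over
    \<open>K\<close>, and \<open>s\<close> commutes with these, so one element decides.\<close>
  have img: "s ` F \<subseteq> F \<longleftrightarrow> s a \<in> F" if s: "s \<in> Aut R K E" for s
  proof
    assume sa: "s a \<in> F"
    show "s ` F \<subseteq> F"
    proof
      fix w assume "w \<in> s ` F"
      then obtain z where z: "z \<in> F" "w = s z" by blast
      obtain p where p: "set p \<subseteq> K" "z = eval p a"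
        using simple_extensionE[OF intermediate_base aR, unfolded a(2), OF z(1)] by blast
      have "w = eval p (s a)" using Aut_eval[OF s E_subfield _ p(1) aE] base_sub z(2) p(2) by simp
      then show "w \<in> F" using eval_in_subfield[of F p "s a"] F p(1) sa by blast
    qed
  qed (use a(1) in blast)
  \<comment> \<open>Transitivity of \<open>G\<close> reaches every conjugate of \<open>a\<close>;
    when the conjugate lies in \<open>F\<close>, the automorphism used is in the normalizer by
    \<open>img\<close>.\<close>
  have "orbit (G\<lparr>carrier := ?N\<rparr>) (\<lambda>\<phi>. \<phi>) a = conjugates K a \<inter> F"
  proof -
    have "orbit (G\<lparr>carrier := ?N\<rparr>) (\<lambda>\<phi>. \<phi>) a = {s a | s. s \<in> Aut R K E \<and> s a \<in> F}"
      unfolding orbit_def normalizer_Aut[OF F] using img by auto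
    also have "\<dots> = conjugates K a \<inter> F"
      using Aut_transitive[OF base_sub aE] Aut_conjugate[OF _ intermediate_base E_subfield _ aE] base_sub
      by auto
    finally show ?thesis .
  qed
  moreover have "stabilizer (G\<lparr>carrier := ?N\<rparr>) (\<lambda>\<phi>. \<phi>) a = ?H"
  proof
    show "stabilizer (G\<lparr>carrier := ?N\<rparr>) (\<lambda>\<phi>. \<phi>) a \<subseteq> ?H"
    proof
      fix s assume "s \<in> stabilizer (G\<lparr>carrier := ?N\<rparr>) (\<lambda>\<phi>. \<phi>) a"
      then have s: "s \<in> Aut R K E" "s a = a" unfolding stabilizer_def using NG by auto
      have "s z = z" if "z \<in> F" for z
      proof -
        obtain p where p: "set p \<subseteq> K" "z = eval p a"
          using simple_extensionE[OF intermediate_base aR, unfolded a(2), OF \<open>z \<in> F\<close>] by blast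
        then show ?thesis using Aut_eval[OF s(1) E_subfield _ p(1) aE] base_sub s(2) by simp
      qed
      then show "s \<in> ?H" using s(1) unfolding Aut_def by simp
    qed
    show "?H \<subseteq> stabilizer (G\<lparr>carrier := ?N\<rparr>) (\<lambda>\<phi>. \<phi>) a"
      using HN Aut_hom(4)[OF _ a(1)] unfolding stabilizer_def by auto
  qed
  ultimately show ?thesis
    using AN.orbit_stabilizer_theorem[OF aE] a(3) unfolding order_def by simp
qed

end

section \<open>The fixed field of the normalizer\<close>

context galois_setting
begin

text \<open>One step of the field chain. By Artin's theorem the Galois group over this field is the
  normalizer itself, so iterating \<open>descend\<close> on fields mirrors iterating
  \<open>normalizer\<close> on subgroups.\<close>

definition descend :: "'a set \<Rightarrow> 'a set" where
  "descend F = fixed_field E (normalizer G (Aut R F E))"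

lemma normalizer_subgroup:
  assumes "sub_extension F"
  shows "subgroup (normalizer G (Aut R F E)) G" "normalizer G (Aut R F E) \<subseteq> Aut R K E"
    "Aut R F E \<subseteq> normalizer G (Aut R F E)"
proof -
  interpret G: group G using group_G[OF base_sub] .
  show "subgroup (normalizer G (Aut R F E)) G"
    using G.normalizer_imp_subgroup Aut_antimono assms by simp
  show "normalizer G (Aut R F E) \<subseteq> Aut R K E" unfolding normalizer_Aut[OF assms] by blast
  show "Aut R F E \<subseteq> normalizer G (Aut R F E)"
  proof
    fix \<phi> assume \<phi>: "\<phi> \<in> Aut R F E"
    then have "\<phi> ` F \<subseteq> F" using Aut_hom(4)[OF \<phi>] by auto
    then show "\<phi> \<in> normalizer G (Aut R F E)"
      unfolding normalizer_Aut[OF assms] using \<phi> Aut_antimono[of K F E] assms by blast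
  qed
qed

lemma descend_sub:
  assumes "sub_extension F"
  shows "sub_extension (descend F)" "descend F \<subseteq> F" "Aut R (descend F) E = normalizer G (Aut R F E)"
proof -
  note N = normalizer_subgroup[OF assms]
  show "sub_extension (descend F)" unfolding descend_def using fixed_field_sub_extension[OF N(2)] .
  have "descend F \<subseteq> fixed_field E (Aut R F E)"
    unfolding descend_def fixed_field_def using N(3) by blast
  then show "descend F \<subseteq> F" unfolding fixed_field_Aut[OF assms] .
  show "Aut R (descend F) E = normalizer G (Aut R F E)"
    unfolding descend_def by (rule Aut_fixed_field[OF N(1)])
qed

lemma cluster_size_pos:
  assumes "sub_extension F"
  shows "cluster_size R K F > 0"
proof -
  have "finite_ext R K F" using finite_ext_sub[OF base_sub assms] assms by blast
  then obtain a where a: "a \<in> F" "cluster_size R K F = card (conjugates K a \<inter> F)"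
    using cluster_sizeE by metis
  have "a \<in> carrier R" using a(1) assms E_carrier by blast
  then show ?thesis
    using a card_conjugates(1)[OF intermediate_base] self_conjugate[OF intermediate_base]
    by (auto simp: card_gt_0_iff)
qed

lemma dim_descend:
  assumes "sub_extension F"
  shows "dim (descend F) F = cluster_size R K F"
proof -
  note D = descend_sub[OF assms]
  have "dim (descend F) F * dim F E = dim (descend F) E"
    using dim_sub_tower[OF D(1) assms D(2)] by simp
  also have "\<dots> = cluster_size R K F * dim F E"
    using card_normalizer[OF assms] card_Aut(2)[OF D(1)] card_Aut(2)[OF assms] D(3) by simp
  finally show ?thesis using dim_E_pos[OF assms] by simp
qed

text \<open>Conjugates over \<open>descend F\<close> are images under the normalizer, whose elements
  map \<open>F\<close> into itself.\<close>

lemma galois_descend: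
  assumes "sub_extension F"
  shows "galois_ext R (descend F) F"
proof (rule galois_extI)
  note D = descend_sub[OF assms]
  show "intermediate (descend F)" using D(1) by blast
  show "finite_ext R (descend F) F" using finite_ext_sub[OF D(1) assms D(2)] .
  fix x assume x: "x \<in> F"
  show "conjugates (descend F) x \<subseteq> F"
  proof
    fix y assume y: "y \<in> conjugates (descend F) x"
    have "x \<in> E" using x assms by blast
    then obtain \<phi> where "\<phi> \<in> Aut R (descend F) E" "\<phi> x = y"
      using Aut_transitive[OF D(1) _ y] by blast
    then show "y \<in> F" using x unfolding D(3) normalizer_Aut[OF assms] by blast
  qed
qed

lemma galois_conjugates:
  assumes "galois_ext R F M" "x \<in> M"
  shows "conjugates F x \<subseteq> M"
  using assms unfolding galois_ext_def normal_ext_def conjugates_def by blast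

lemma galois_Aut_subset_normalizer:
  assumes F: "sub_extension F" and N: "sub_extension N" "N \<subseteq> F" "galois_ext R N F"
  shows "Aut R N E \<subseteq> normalizer G (Aut R F E)"
proof
  fix \<phi> assume \<phi>: "\<phi> \<in> Aut R N E"
  have "\<phi> ` F \<subseteq> F"
    using Aut_conjugate[OF \<phi> _ E_subfield] galois_conjugates[OF N(3)] N(1) F by blast
  then show "\<phi> \<in> normalizer G (Aut R F E)"
    unfolding normalizer_Aut[OF F] using \<phi> Aut_antimono[of K N E] N(1) by blast
qed

lemma Aut_inject:
  assumes "sub_extension F" "sub_extension F'"
  shows "Aut R F E = Aut R F' E \<longleftrightarrow> F = F'"
proof
  assume "Aut R F E = Aut R F' E"
  then have "fixed_field E (Aut R F E) = fixed_field E (Aut R F' E)" by (rule arg_cong)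
  then show "F = F'" unfolding fixed_field_Aut[OF assms(1)] fixed_field_Aut[OF assms(2)] .
qed simp

text \<open>Equal degrees give \<open>Aut R N E\<close> the order of the normalizer that contains
  it, so the two groups coincide, and a field is determined by its group.\<close>

lemma descend_unique:
  assumes F: "sub_extension F" and N: "sub_extension N" "N \<subseteq> F" "galois_ext R N F"
    and d: "dim N F = cluster_size R K F"
  shows "N = descend F"
proof -
  note D = descend_sub[OF F]
  have "dim N E = dim (descend F) E"
    unfolding dim_sub_tower[OF N(1) F N(2)] dim_sub_tower[OF D(1) F D(2)] d dim_descend[OF F] ..
  then have c: "card (Aut R N E) = card (Aut R (descend F) E)"
    unfolding card_Aut(2)[OF N(1)] card_Aut(2)[OF D(1)] .
  have "Aut R N E = Aut R (descend F) E"
    by (rule card_subset_eq[OF card_Aut(1)[OF D(1)] _ c])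
      (use galois_Aut_subset_normalizer[OF F N] D(3) in simp)
  then show ?thesis unfolding Aut_inject[OF N(1) D(1)] .
qed

text \<open>\<open>cluster_s\<close> is a quotient of natural numbers. The division is exact because
  the tower through \<open>descend F\<close> exhibits the cluster size as a factor of the
  degree.\<close>

lemma dim_base_descend:
  assumes "sub_extension F"
  shows "dim K (descend F) = cluster_s R K F"
proof -
  note D = descend_sub[OF assms]
  have "dim K F = dim K (descend F) * cluster_size R K F"
  proof -
    have "finite_ext R K F" using finite_ext_sub[OF base_sub assms] assms by blast
    then show ?thesis
      using dim_tower[of F K "descend F"] intermediate_base D dim_descend[OF assms] by simp
  qed
  then show ?thesis
    using cluster_size_pos[OF assms] unfolding cluster_s_def ext_degree_def by simp
qed

text \<open>Lagrange's theorem in product form: \<open>cluster_s\<close> is the index in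
  \<open>G\<close> of the Galois group over \<open>descend F\<close>.\<close>

lemma cluster_s_card:
  assumes "sub_extension F"
  shows "cluster_s R K F * card (Aut R (descend F) E) = card (carrier G)"
  using dim_base_descend[OF assms] dim_sub_tower[OF base_sub descend_sub(1)[OF assms]]
    descend_sub(1)[OF assms] card_Aut(2)[OF base_sub] card_Aut(2)[OF descend_sub(1)[OF assms]] by simp

lemma cluster_size_card:
  assumes "sub_extension F"
  shows "cluster_size R K F * card (Aut R F E) = card (Aut R (descend F) E)"
  using card_normalizer[OF assms] descend_sub(3)[OF assms] by simp

text \<open>Links the stopping conditions of the two chains: the order of the normalizer is the
  cluster size times the order of the subgroup, so cluster size one and self-normalizing mean the
  same.\<close>

lemma descend_eq_self_iff:
  assumes "sub_extension F"
  shows "descend F = F \<longleftrightarrow> cluster_size R K F = 1"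
    and "descend F = F \<longleftrightarrow> normalizer G (Aut R F E) = Aut R F E"
proof -
  note D = descend_sub[OF assms]
  show iff: "descend F = F \<longleftrightarrow> normalizer G (Aut R F E) = Aut R F E"
    using Aut_inject[OF D(1) assms] D(3) by simp
  show "descend F = F \<longleftrightarrow> cluster_size R K F = 1"
  proof
    assume "descend F = F"
    then show "cluster_size R K F = 1" using dim_descend[OF assms] dim_self assms by simp
  next
    assume "cluster_size R K F = 1"
    then have "card (Aut R F E) = card (normalizer G (Aut R F E))" using card_normalizer[OF assms] by simp
    moreover have "finite (normalizer G (Aut R F E))" using card_Aut(1)[OF D(1)] D(3) by simp
    ultimately have "Aut R F E = normalizer G (Aut R F E)"
      using card_subset_eq normalizer_subgroup(3)[OF assms] by blast
    then show "descend F = F" using iff by simp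
  qed
qed

lemma descend_eq_base_iff:
  assumes "sub_extension F"
  shows "descend F = K \<longleftrightarrow> normalizer G (Aut R F E) = carrier G"
    and "descend F = K \<longleftrightarrow> galois_ext R K F"
proof -
  note D = descend_sub[OF assms]
  show iff: "descend F = K \<longleftrightarrow> normalizer G (Aut R F E) = carrier G"
    using Aut_inject[OF D(1) base_sub] D(3) by simp
  show "descend F = K \<longleftrightarrow> galois_ext R K F"
  proof
    assume "descend F = K" then show "galois_ext R K F" using galois_descend[OF assms] by simp
  next
    assume "galois_ext R K F"
    then have "Aut R K E \<subseteq> normalizer G (Aut R F E)"
      using galois_Aut_subset_normalizer[OF assms base_sub] assms by blast
    then show "descend F = K" unfolding iff using normalizer_subgroup(2)[OF assms] by auto
  qed
qed

lemma descend_base: "descend K = K"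
  by (rule equalityI) (use descend_sub(1,2)[OF base_sub] in simp_all)

end

lemma (in group) normal_iff_normalizer:
  assumes "subgroup H G" "finite H"
  shows "normal H G \<longleftrightarrow> normalizer G H = carrier G"
proof
  assume "normal H G"
  then show "normalizer G H = carrier G"
    unfolding normalizer_eq_conjugation[OF assms] using normal.inv_op_closed1[OF \<open>normal H G\<close>] by blast
next
  assume "normalizer G H = carrier G"
  then show "normal H G" using subgroup_in_normalizer[OF assms(1)] by simp
qed

section \<open>Existence of the Galois closure\<close>

context perfect_closure
begin

text \<open>\<open>E\<close> is generated by all conjugates of a primitive element of
  \<open>L\<close>. Given an embedding \<open>h\<close> of \<open>E\<close> that moves the generator
  \<open>t\<close> to a conjugate, the elements of \<open>E\<close> that \<open>h\<close> keeps in
  \<open>E\<close> form a subring. It contains \<open>K\<close> and the generating conjugates, which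
  \<open>h\<close> maps among themselves, so it is all of \<open>E\<close>.\<close>

lemma exists_galois_setting:
  assumes ext: "finite_ext R K L"
  shows "\<exists>E \<theta>. galois_setting R K E \<theta> \<and> L \<subseteq> E"
proof -
  have L: "subfield L R" using ext unfolding finite_ext_def by simp
  obtain a where a: "a \<in> L" "simple_extension K a = L" using primitive_element[OF ext] by blast
  have aR: "a \<in> carrier R" using a(1) subfieldE(3)[OF L] by blast
  obtain xs where xs: "set xs = conjugates K a"
    using finite_list[OF card_conjugates(1)[OF intermediate_base aR]] by blast
  have xsR: "set xs \<subseteq> carrier R" unfolding xs conjugates_def by blast
  define E where "E = finite_extension K xs"
  have alg: "(algebraic over K) x" if "x \<in> set xs" for x using that xsR algebraic_extension by blast
  have KR: "K \<subseteq> carrier R" using subfieldE(3)[OF subfield_axioms] .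
  note E = finite_extension_is_subfield[OF subfield_axioms xsR alg, folded E_def]
    finite_extension_incl[OF KR xsR, folded E_def]
    finite_extension_mem[OF subfieldE(1)[OF subfield_axioms] xsR, folded E_def]
    finite_extension_finite_dimension(1)[OF subfield_axioms xsR alg, folded E_def]
  then have "finite_ext R K E" unfolding finite_ext_def using subfield_axioms by simp
  then obtain t where t: "t \<in> E" "simple_extension K t = E" using primitive_element by blast
  have tR: "t \<in> carrier R" using t(1) subfieldE(3)[OF E(1)] by blast
  have "a \<in> E" using E(3) xs self_conjugate[OF intermediate_base aR] by blast
  then have LE: "L \<subseteq> E" using simple_extension_least[OF E(1,2)] a(2) by blast
  have "conjugates K t \<subseteq> E"
  proof
    fix y assume y: "y \<in> conjugates K t"
    obtain h where h: "h \<in> ring_hom (R\<lparr>carrier := E\<rparr>) R" "\<forall>a\<in>K. h a = a" "h t = y"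
      using conjugate_hom[OF intermediate_base tR y] unfolding t(2) by blast
    interpret h: ring_hom_ring "R\<lparr>carrier := E\<rparr>" R h
      using ring_hom_ringI2[OF _ ring_axioms h(1)] subring_is_ring[OF subfieldE(1)[OF E(1)]] by blast
    note Er = subringE[OF subfieldE(1)[OF E(1)]]
    have ops: "h (u \<oplus> v) = h u \<oplus> h v" "h (u \<otimes> v) = h u \<otimes> h v" if "u \<in> E" "v \<in> E" for u v
      using h.hom_add[of u v] h.hom_mult[of u v] that by auto
    let ?T = "{x \<in> E. h x \<in> E}"
    have "subring ?T R"
    proof (rule subringI)
      show "?T \<subseteq> carrier R" using Er(1) by blast
      show "\<one> \<in> ?T" using Er(3) h.hom_one by simp
      fix u assume u: "u \<in> ?T"
      then have uE: "u \<in> E" "h u \<in> E" by simp_all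
      then have uE: "u \<in> E" "h u \<in> E" "\<ominus> u \<in> E" "u \<in> carrier R" "h u \<in> carrier R"
        using Er(5) subsetD[OF Er(1)] by simp_all
      have "h (\<ominus> u) \<oplus> h u = h (\<ominus> u \<oplus> u)" using ops(1)[OF uE(3,1)] by simp
      also have "\<dots> = \<zero>" using h.hom_zero uE(4) by (simp add: l_neg)
      finally have "h (\<ominus> u) = \<ominus> h u"
        using minus_equality[of "h (\<ominus> u)" "h u"] h.hom_closed[of "\<ominus> u"] uE by simp
      then show "\<ominus> u \<in> ?T" using uE(2,3) Er(5) by simp
      fix v assume v: "v \<in> ?T"
      show "u \<otimes> v \<in> ?T" "u \<oplus> v \<in> ?T" using u v ops Er(6,7) by simp_all
    qed
    moreover have "K \<subseteq> ?T" using h(2) E(2) by auto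
    moreover have "set xs \<subseteq> ?T"
    proof
      fix x assume x: "x \<in> set xs"
      then have xE: "x \<in> E" using E(3) by blast
      have "h (eval (Irr K a) x) = eval (Irr K a) (h x)"
        by (rule hom_eval[OF h(1) E(1) bspec[OF h(2)] E(2) Irr_props(4)[OF intermediate_base aR] xE])
      moreover have "eval (Irr K a) x = \<zero>" using x unfolding xs conjugates_def by simp
      ultimately have "eval (Irr K a) (h x) = \<zero>" using h.hom_zero by simp
      then have "h x \<in> set xs" unfolding xs conjugates_def using h.hom_closed[of x] xE by simp
      then show "x \<in> ?T" using xE E(3) by blast
    qed
    ultimately have "E \<subseteq> ?T" by (rule finite_extension_subring_incl[where K = K and xs = xs, folded E_def])
    then show "y \<in> E" using t(1) h(3) by blast
  qed
  then have "galois_setting R K E t"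
    using tR t(2) by unfold_locales auto
  then show ?thesis using LE by blast
qed

text \<open>The field from \<open>exists_galois_setting\<close> is one member of the intersected
  family, so the intersection is a finite extension and has a primitive element. The conjugates of
  that element lie in every member, hence in the intersection.\<close>

lemma galois_setting_closure:
  assumes ext: "finite_ext R K L"
  shows "\<exists>\<theta>. galois_setting R K (galois_closure R K L) \<theta>" "L \<subseteq> galois_closure R K L"
proof -
  obtain E t where E: "galois_setting R K E t" "L \<subseteq> E" using exists_galois_setting[OF ext] by blast
  interpret E: galois_setting R K E t using E(1) .
  let ?C = "galois_closure R K L" and ?S = "{M. L \<subseteq> M \<and> galois_ext R K M}"
  have C: "?C = \<Inter>?S" unfolding galois_closure_def ..
  have ES: "E \<in> ?S" using E(2) E.E_galois by blast
  have S: "subfield M R" "K \<subseteq> M" if "M \<in> ?S" for M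
    using that unfolding galois_ext_def finite_ext_def by auto
  show LC: "L \<subseteq> ?C" unfolding C by blast
  have "subfield ?C R"
  proof (rule subfieldI')
    show "subring ?C R"
    proof (rule subringI)
      have Sr: "subring M R" if "M \<in> ?S" for M using subfieldE(1)[OF S(1)[OF that]] .
      show "?C \<subseteq> carrier R" unfolding C using ES E.E_carrier by blast
      show "\<one> \<in> ?C" unfolding C using subringE(3)[OF Sr] by (rule InterI)
      fix u v assume u: "u \<in> ?C" and v: "v \<in> ?C"
      have uv: "u \<in> M" "v \<in> M" if "M \<in> ?S" for M using u v that unfolding C by (blast, blast)
      show "\<ominus> u \<in> ?C" unfolding C by (rule InterI) (rule subringE(5)[OF Sr uv(1)])
      show "u \<otimes> v \<in> ?C" unfolding C by (rule InterI) (rule subringE(6)[OF Sr uv])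
      show "u \<oplus> v \<in> ?C" unfolding C by (rule InterI) (rule subringE(7)[OF Sr uv])
    qed
    fix k assume k: "k \<in> ?C - {\<zero>}"
    have "inv k \<in> M" if "M \<in> ?S" for M
      using subfield_m_inv(1)[OF S(1)[OF that], of k] k that unfolding C by blast
    then show "inv k \<in> ?C" unfolding C by blast
  qed
  moreover have "K \<subseteq> ?C" unfolding C using S(2) by blast
  moreover have "?C \<subseteq> E" unfolding C using ES by blast
  ultimately have fin: "finite_ext R K ?C"
    using finite_ext_tower[OF E.E_finite intermediate_base] by blast
  then obtain c where c: "c \<in> ?C" "simple_extension K c = ?C" using primitive_element by blast
  have cR: "c \<in> carrier R" using c(1) \<open>?C \<subseteq> E\<close> E.E_carrier by blast
  have "conjugates K c \<subseteq> M" if M: "M \<in> ?S" for M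
  proof -
    have "c \<in> M" using c(1) M unfolding C by blast
    then show ?thesis using M unfolding galois_ext_def normal_ext_def conjugates_def by blast
  qed
  then have "conjugates K c \<subseteq> ?C" unfolding C by blast
  then have "galois_setting R K ?C c" using cR c(2) by unfold_locales auto
  then show "\<exists>\<theta>. galois_setting R K ?C \<theta>" by blast
qed

end

section \<open>Chains of iterates\<close>

text \<open>The common shape of both chains: iterate \<open>f\<close> from \<open>x\<close> and stop
  at the first fixed point. It is applied with \<open>descend\<close> and with
  \<open>normalizer G\<close>.\<close>

definition iterate_chain :: "('b \<Rightarrow> 'b) \<Rightarrow> 'b \<Rightarrow> 'b list \<Rightarrow> bool" where
  "iterate_chain f x xs \<longleftrightarrow> xs \<noteq> [] \<and> xs ! 0 = x \<and>
     (\<forall>i. 1 \<le> i \<and> i < length xs \<longrightarrow> xs ! i = f (xs ! (i - 1)) \<and> xs ! i \<noteq> xs ! (i - 1)) \<and>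
     f (last xs) = last xs"

lemma iterate_chain_single: "iterate_chain f x [y] \<longleftrightarrow> y = x \<and> f x = x"
  unfolding iterate_chain_def by auto

lemma iterate_chain_Cons:
  "iterate_chain f x (y # z # zs) \<longleftrightarrow> y = x \<and> f x \<noteq> x \<and> iterate_chain f (f x) (z # zs)"
proof -
  have "(\<forall>i. 1 \<le> i \<and> i < length (y # z # zs) \<longrightarrow> (y # z # zs) ! i = f ((y # z # zs) ! (i - 1)) \<and>
           (y # z # zs) ! i \<noteq> (y # z # zs) ! (i - 1)) \<longleftrightarrow>
    (z = f y \<and> z \<noteq> y) \<and> (\<forall>i. 1 \<le> i \<and> i < length (z # zs) \<longrightarrow> (z # zs) ! i = f ((z # zs) ! (i - 1)) \<and>
           (z # zs) ! i \<noteq> (z # zs) ! (i - 1))" (is "(\<forall>i. ?P i) \<longleftrightarrow> ?Q \<and> (\<forall>i. ?R i)")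
  proof -
    have all_nat: "(\<forall>i. Q i) \<longleftrightarrow> Q 0 \<and> (\<forall>i. Q (Suc i))" for Q :: "nat \<Rightarrow> bool"
      by (metis not0_implies_Suc)
    show ?thesis
      unfolding all_nat[of ?P] all_nat[of "\<lambda>i. ?P (Suc i)"] all_nat[of ?R] by simp
  qed
  then show ?thesis unfolding iterate_chain_def by auto
qed

text \<open>At each entry the alternatives exclude one another: a chain ends only at a fixed point
  of \<open>f\<close> and continues only where \<open>f\<close> moves the entry.\<close>

lemma iterate_chain_unique:
  "iterate_chain f x xs \<Longrightarrow> iterate_chain f x ys \<Longrightarrow> xs = ys"
proof (induct xs arbitrary: x ys)
  case Nil then show ?case unfolding iterate_chain_def by simp
next
  case (Cons a xs)
  have "ys \<noteq> []" using Cons(3) unfolding iterate_chain_def by blast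
  then obtain b zs where ys: "ys = b # zs" by (cases ys) auto
  show ?case
    using Cons unfolding ys
    by (cases xs; cases zs) (auto simp: iterate_chain_single iterate_chain_Cons)
qed

lemma iterate_chain_exists:
  fixes m :: "'b \<Rightarrow> nat"
  assumes "P x" "\<And>y. P y \<Longrightarrow> P (f y)" "\<And>y. P y \<Longrightarrow> f y \<noteq> y \<Longrightarrow> m (f y) < m y"
  shows "\<exists>xs. iterate_chain f x xs"
  using assms(1)
proof (induct "m x" arbitrary: x rule: less_induct)
  case less
  show ?case
  proof (cases "f x = x")
    case True then show ?thesis using iterate_chain_single[of f x x] by blast
  next
    case False
    obtain xs where xs: "iterate_chain f (f x) xs"
      using less(1)[OF assms(3)[OF less(2) False] assms(2)[OF less(2)]] by blast
    then obtain z zs where "xs = z # zs" unfolding iterate_chain_def by (cases xs) auto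
    then show ?thesis using xs False iterate_chain_Cons[of f x x z zs] by blast
  qed
qed

lemma iterate_chain_invariant:
  assumes "iterate_chain f x xs" "P x" "\<And>y. P y \<Longrightarrow> P (f y)"
  shows "y \<in> set xs \<Longrightarrow> P y"
  using assms(1,2)
proof (induct xs arbitrary: x)
  case (Cons a xs)
  then show ?case using assms(3)
    by (cases xs) (auto simp: iterate_chain_single iterate_chain_Cons)
qed simp

lemma iterate_chain_two: "iterate_chain f x [x, y] \<longleftrightarrow> f x = y \<and> y \<noteq> x \<and> f y = y"
  by (auto simp: iterate_chain_Cons iterate_chain_single)

lemma iterate_chain_three:
  "iterate_chain f x [x, y, z] \<longleftrightarrow> f x = y \<and> y \<noteq> x \<and> f y = z \<and> z \<noteq> y \<and> f z = z"
  by (auto simp: iterate_chain_Cons iterate_chain_single)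

section \<open>The chain of subfields and the chain of normalizers\<close>

context galois_setting
begin

lemma descend_chain_sub_extension:
  assumes "sub_extension L" "y \<in> set Ns" "iterate_chain descend L Ns"
  shows "sub_extension y"
  using iterate_chain_invariant[OF assms(3), of sub_extension y] assms(1,2) descend_sub(1) by blast

text \<open>\<open>descend_unique\<close> turns the Galois and degree conditions on consecutive
  fields into the equation that the next field is \<open>descend\<close> of the previous
  one.\<close>

lemma field_chain_iff:
  assumes L: "sub_extension L"
  shows "field_chain R K L Ns \<longleftrightarrow> iterate_chain descend L Ns"
proof
  assume c: "field_chain R K L Ns"
  then have ne: "Ns \<noteq> []" and zero: "Ns ! 0 = L"
    and int: "\<And>i. i < length Ns \<Longrightarrow> intermediate (Ns ! i)"
    and step: "\<And>i. 1 \<le> i \<Longrightarrow> i < length Ns \<Longrightarrow> Ns ! i \<subset> Ns ! (i - 1) \<and>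
      galois_ext R (Ns ! i) (Ns ! (i - 1)) \<and>
      ext_degree R (Ns ! i) (Ns ! (i - 1)) = cluster_size R K (Ns ! (i - 1))"
    and final: "cluster_size R K (last Ns) = 1"
    unfolding field_chain_def by blast+
  \<comment> \<open>Containment in \<open>E\<close> is not part of \<open>field_chain\<close>; it is
    inherited downwards from \<open>L\<close>.\<close>
  have sub: "sub_extension (Ns ! i)" if "i < length Ns" for i
    using that
  proof (induct i)
    case 0 then show ?case using zero L by simp
  next
    case (Suc i)
    then have "Ns ! i \<subseteq> E" "Ns ! Suc i \<subset> Ns ! i" using step[of "Suc i"] by auto
    then show ?case using int[OF Suc(2)] by blast
  qed
  have "Ns ! i = descend (Ns ! (i - 1))" if i: "1 \<le> i" "i < length Ns" for i
  proof (rule descend_unique)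
    show "sub_extension (Ns ! (i - 1))" "sub_extension (Ns ! i)" using sub[of "i - 1"] sub[of i] i by simp_all
    show "Ns ! i \<subseteq> Ns ! (i - 1)" "galois_ext R (Ns ! i) (Ns ! (i - 1))"
      "dim (Ns ! i) (Ns ! (i - 1)) = cluster_size R K (Ns ! (i - 1))"
      using step[OF i] unfolding ext_degree_def by blast+
  qed
  moreover have "descend (last Ns) = last Ns"
  proof -
    have "sub_extension (last Ns)" unfolding last_conv_nth[OF ne] using sub[of "length Ns - 1"] ne by simp
    then show ?thesis using descend_eq_self_iff(1) final by blast
  qed
  ultimately show "iterate_chain descend L Ns"
    unfolding iterate_chain_def using ne zero step by blast
next
  assume c: "iterate_chain descend L Ns"
  then have ne: "Ns \<noteq> []" and zero: "Ns ! 0 = L"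
    and step: "\<And>i. 1 \<le> i \<Longrightarrow> i < length Ns \<Longrightarrow> Ns ! i = descend (Ns ! (i - 1)) \<and> Ns ! i \<noteq> Ns ! (i - 1)"
    and final: "descend (last Ns) = last Ns"
    unfolding iterate_chain_def by blast+
  have sub: "sub_extension (Ns ! i)" if "i < length Ns" for i
    using descend_chain_sub_extension[OF L nth_mem[OF that] c] .
  have "Ns ! i \<subset> Ns ! (i - 1) \<and> galois_ext R (Ns ! i) (Ns ! (i - 1)) \<and>
      ext_degree R (Ns ! i) (Ns ! (i - 1)) = cluster_size R K (Ns ! (i - 1))"
    if i: "1 \<le> i" "i < length Ns" for i
  proof -
    have s: "sub_extension (Ns ! (i - 1))" using sub[of "i - 1"] i by simp
    then show ?thesis
      using descend_sub(2)[OF s] galois_descend[OF s] dim_descend[OF s] step[OF i]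
      unfolding ext_degree_def by auto
  qed
  moreover have "cluster_size R K (last Ns) = 1"
    using descend_eq_self_iff(1) sub[of "length Ns - 1"] ne final by (simp add: last_conv_nth)
  ultimately show "field_chain R K L Ns"
    unfolding field_chain_def using ne zero sub by blast
qed

text \<open>Gives uniqueness of the group chain; its existence comes from applying
  \<open>Aut\<close> to the field chain.\<close>

lemma group_chain_iterate:
  "group_chain G H Hs \<Longrightarrow> iterate_chain (normalizer G) H Hs"
  unfolding group_chain_def iterate_chain_def by blast

lemma group_chain_map_Aut:
  assumes L: "sub_extension L" and c: "iterate_chain descend L Ns"
  shows "group_chain G (Aut R L E) (map (\<lambda>F. Aut R F E) Ns)" (is "group_chain G _ ?Hs")
proof -
  have ne: "Ns \<noteq> []" and zero: "Ns ! 0 = L"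
    and step: "\<And>i. 1 \<le> i \<Longrightarrow> i < length Ns \<Longrightarrow> Ns ! i = descend (Ns ! (i - 1)) \<and> Ns ! i \<noteq> Ns ! (i - 1)"
    and final: "descend (last Ns) = last Ns"
    using c unfolding iterate_chain_def by blast+
  have sub: "sub_extension (Ns ! i)" if "i < length Ns" for i
    using descend_chain_sub_extension[OF L nth_mem[OF that] c] .
  have "Aut R (Ns ! (i - 1)) E \<subset> Aut R (Ns ! i) E \<and> Aut R (Ns ! i) E = normalizer G (Aut R (Ns ! (i - 1)) E)"
    if i: "1 \<le> i" "i < length Ns" for i
  proof -
    have s: "sub_extension (Ns ! (i - 1))" "sub_extension (Ns ! i)" using sub[of "i - 1"] sub[of i] i by simp_all
    have "Aut R (Ns ! (i - 1)) E \<noteq> Aut R (Ns ! i) E"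
      unfolding Aut_inject[OF s] using step[OF i] by metis
    moreover have "Aut R (Ns ! i) E = normalizer G (Aut R (Ns ! (i - 1)) E)"
      using descend_sub(3)[OF s(1)] step[OF i] by simp
    ultimately show ?thesis using normalizer_subgroup(3)[OF s(1)] by blast
  qed
  note star = this
  have nth: "?Hs ! i = Aut R (Ns ! i) E" if "i < length Ns" for i using that by simp
  have "?Hs ! (i - 1) \<subset> ?Hs ! i \<and> ?Hs ! i = normalizer G (?Hs ! (i - 1))"
    if i: "1 \<le> i" "i < length Ns" for i
  proof -
    have i': "i - 1 < length Ns" using i by simp
    show ?thesis unfolding nth[OF i(2)] nth[OF i'] by (rule star[OF i])
  qed
  then have "\<forall>i. 1 \<le> i \<and> i < length ?Hs \<longrightarrow> ?Hs ! (i - 1) \<subset> ?Hs ! i \<and> ?Hs ! i = normalizer G (?Hs ! (i - 1))"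
    unfolding length_map by blast
  moreover have "normalizer G (last ?Hs) = last ?Hs"
    unfolding last_map[OF ne] using descend_eq_self_iff(2) sub[of "length Ns - 1"] ne final
    by (simp add: last_conv_nth)
  moreover have "?Hs \<noteq> []" "?Hs ! 0 = Aut R L E" using ne zero by simp_all
  moreover have "\<forall>i<length ?Hs. subgroup (?Hs ! i) G" using Aut_subgroup[OF sub] nth by simp
  ultimately show ?thesis unfolding group_chain_def by (intro conjI)
qed

text \<open>The degree over \<open>K\<close> serves as measure: a step that moves \<open>F\<close>
  divides it by a cluster size greater than one.\<close>

lemma descend_chain_exists:
  assumes "sub_extension L"
  shows "\<exists>Ns. iterate_chain descend L Ns"
proof (rule iterate_chain_exists[where P = sub_extension and m = "dim K"])
  show "sub_extension L" by fact
  show "sub_extension (descend F)" if "sub_extension F" for F using descend_sub(1)[OF that] .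
  show "dim K (descend F) < dim K F" if F: "sub_extension F" and ne: "descend F \<noteq> F" for F
  proof -
    note D = descend_sub[OF F]
    have "cluster_size R K F \<noteq> 1" using descend_eq_self_iff(1)[OF F] ne by blast
    then have r: "cluster_size R K F > 1" using cluster_size_pos[OF F] by linarith
    have "dim K E = dim K (descend F) * dim (descend F) E"
      using dim_sub_tower[OF base_sub D(1)] D(1) by blast
    then have "dim K (descend F) > 0" using dim_E_pos[OF base_sub] by simp
    have "finite_ext R K F" using finite_ext_sub[OF base_sub F] F by blast
    then have "dim K F = dim K (descend F) * cluster_size R K F"
      using dim_tower[of F K "descend F"] intermediate_base D dim_descend[OF F] by simp
    then show ?thesis using r \<open>dim K (descend F) > 0\<close> by simp
  qed
qed

text \<open>Valid in any Galois setting that contains \<open>L\<close>; the Galois closure enters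
  only as an instance of \<open>E\<close>.\<close>

theorem normalizer_chain:
  assumes L: "sub_extension L" and LK: "L \<noteq> K"
    and H: "H = Aut R L E"
    and N: "N = fixed_field E (normalizer G (Aut R L E))"
  shows "(subfield N R \<and> K \<subseteq> N \<and> N \<subseteq> L \<and> galois_ext R N L \<and>
         ext_degree R N L = cluster_size R K L \<and>
         (\<forall>N'. subfield N' R \<and> K \<subseteq> N' \<and> N' \<subseteq> L \<and> galois_ext R N' L \<and>
               ext_degree R N' L = cluster_size R K L \<longrightarrow> N' = N) \<and>
         ext_degree R K N = cluster_s R K L) \<and>
        (\<exists>!Ns. field_chain R K L Ns) \<and>
        (\<forall>Ns k. field_chain R K L Ns \<and> k = length Ns - 1 \<longrightarrow>
          (\<forall>i. 1 \<le> i \<and> i \<le> k \<longrightarrow> ext_degree R K (Ns ! i) = cluster_s R K (Ns ! (i - 1))) \<and>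
          (k \<ge> 1 \<longrightarrow> cluster_s R K (Ns ! (k - 1)) = cluster_s R K (Ns ! k)) \<and>
          (\<exists>!Hs. group_chain G H Hs) \<and>
          (\<forall>Hs. group_chain G H Hs \<longrightarrow>
              length Hs = length Ns \<and>
              (\<forall>i \<le> k. Ns ! i = fixed_field E (Hs ! i)) \<and>
              (\<forall>i. 1 \<le> i \<and> i \<le> k \<longrightarrow> normal (Hs ! (i - 1)) (G\<lparr>carrier := Hs ! i\<rparr>)) \<and>
              (\<forall>i < k. cluster_size R K (Ns ! i) * card (Hs ! i) = card (Hs ! Suc i) \<and>
                       cluster_s R K (Ns ! i) * card (Hs ! Suc i) = card (carrier G))) \<and>
          weak_cluster_magnification R K (last Ns) L \<and>
          magnification_factor R K (last Ns) L = cluster_size R K L \<and>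
          (k \<ge> 1 \<longrightarrow> (last Ns = K \<longleftrightarrow> galois_ext R K (Ns ! (k - 1)))) \<and>
          (cluster_size R K L = 1 \<longleftrightarrow> normalizer G H = H) \<and>
          (normalizer G H = H \<longleftrightarrow> Ns = [L]) \<and>
          (galois_ext R K L \<longleftrightarrow> normalizer G H = carrier G) \<and>
          (normalizer G H = carrier G \<longleftrightarrow> Ns = [L, K]) \<and>
          (normalizer G H \<noteq> carrier G \<and> normal (normalizer G H) G \<longleftrightarrow> Ns = [L, N, K]))"
proof -
  interpret G: group G using group_G[OF base_sub] .
  have N': "N = descend L" unfolding N descend_def ..
  note D = descend_sub[OF L]
  have part1: "subfield N R \<and> K \<subseteq> N \<and> N \<subseteq> L \<and> galois_ext R N L \<and>
         ext_degree R N L = cluster_size R K L \<and>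
         (\<forall>N'. subfield N' R \<and> K \<subseteq> N' \<and> N' \<subseteq> L \<and> galois_ext R N' L \<and>
               ext_degree R N' L = cluster_size R K L \<longrightarrow> N' = N) \<and>
         ext_degree R K N = cluster_s R K L"
  proof -
    have "N' = N" if n: "subfield N' R" "K \<subseteq> N'" "N' \<subseteq> L" "galois_ext R N' L"
      "ext_degree R N' L = cluster_size R K L" for N'
    proof -
      have "sub_extension N'" using n(1-3) L by blast
      then show ?thesis unfolding N' using descend_unique[OF L _ n(3,4)] n(5) unfolding ext_degree_def by blast
    qed
    then have unique: "\<forall>N'. subfield N' R \<and> K \<subseteq> N' \<and> N' \<subseteq> L \<and> galois_ext R N' L \<and>
        ext_degree R N' L = cluster_size R K L \<longrightarrow> N' = N" by blast
    have "subfield N R" "K \<subseteq> N" "N \<subseteq> L" "galois_ext R N L" "ext_degree R N L = cluster_size R K L"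
      "ext_degree R K N = cluster_s R K L"
      unfolding N' ext_degree_def
      using D(1,2) galois_descend[OF L] dim_descend[OF L] dim_base_descend[OF L] by simp_all
    with unique show ?thesis by (intro conjI)
  qed
  have part2: "\<exists>!Ns. field_chain R K L Ns"
    unfolding field_chain_iff[OF L] using descend_chain_exists[OF L] iterate_chain_unique[of descend L] by (rule ex_ex1I)
  have part3: "(\<forall>i. 1 \<le> i \<and> i \<le> k \<longrightarrow> ext_degree R K (Ns ! i) = cluster_s R K (Ns ! (i - 1))) \<and>
          (k \<ge> 1 \<longrightarrow> cluster_s R K (Ns ! (k - 1)) = cluster_s R K (Ns ! k)) \<and>
          (\<exists>!Hs. group_chain G H Hs) \<and>
          (\<forall>Hs. group_chain G H Hs \<longrightarrow>
              length Hs = length Ns \<and>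
              (\<forall>i \<le> k. Ns ! i = fixed_field E (Hs ! i)) \<and>
              (\<forall>i. 1 \<le> i \<and> i \<le> k \<longrightarrow> normal (Hs ! (i - 1)) (G\<lparr>carrier := Hs ! i\<rparr>)) \<and>
              (\<forall>i < k. cluster_size R K (Ns ! i) * card (Hs ! i) = card (Hs ! Suc i) \<and>
                       cluster_s R K (Ns ! i) * card (Hs ! Suc i) = card (carrier G))) \<and>
          weak_cluster_magnification R K (last Ns) L \<and>
          magnification_factor R K (last Ns) L = cluster_size R K L \<and>
          (k \<ge> 1 \<longrightarrow> (last Ns = K \<longleftrightarrow> galois_ext R K (Ns ! (k - 1)))) \<and>
          (cluster_size R K L = 1 \<longleftrightarrow> normalizer G H = H) \<and>
          (normalizer G H = H \<longleftrightarrow> Ns = [L]) \<and>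
          (galois_ext R K L \<longleftrightarrow> normalizer G H = carrier G) \<and>
          (normalizer G H = carrier G \<longleftrightarrow> Ns = [L, K]) \<and>
          (normalizer G H \<noteq> carrier G \<and> normal (normalizer G H) G \<longleftrightarrow> Ns = [L, N, K])"
    if fc: "field_chain R K L Ns" and k: "k = length Ns - 1" for Ns k
  proof -
    have c: "iterate_chain descend L Ns" using fc unfolding field_chain_iff[OF L] .
    then have ne: "Ns \<noteq> []" unfolding iterate_chain_def by blast
    then have len: "length Ns = Suc k" using k by (cases Ns) auto
    have steps: "\<forall>i. 1 \<le> i \<and> i < length Ns \<longrightarrow> Ns ! i = descend (Ns ! (i - 1)) \<and> Ns ! i \<noteq> Ns ! (i - 1)"
      using c unfolding iterate_chain_def by (elim conjE)
    have step: "Ns ! i = descend (Ns ! (i - 1))" if i: "1 \<le> i" "i \<le> k" for i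
    proof -
      have "i < length Ns" using i(2) len by simp
      then show ?thesis by (rule conjunct1[OF mp[OF spec[OF steps] conjI[OF i(1)]]])
    qed
    have last: "last Ns = Ns ! k" using ne k by (simp add: last_conv_nth)
    have sub: "sub_extension (Ns ! i)" if "i \<le> k" for i
      using descend_chain_sub_extension[OF L nth_mem c] that len by simp
    have deg: "ext_degree R K (Ns ! i) = cluster_s R K (Ns ! (i - 1))" if i: "1 \<le> i" "i \<le> k" for i
      using dim_base_descend[OF sub[of "i - 1"]] step[OF i] i unfolding ext_degree_def by simp
    have last1: "cluster_size R K (last Ns) = 1"
      using fc unfolding field_chain_def by blast
    \<comment> \<open>Cluster size one at the end of the chain makes \<open>cluster_s\<close> the
      full degree there, and by \<open>deg\<close> this degree is also \<open>cluster_s\<close> of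
      the field before it.\<close>
    have s_last: "cluster_s R K (Ns ! k) = ext_degree R K (Ns ! k)"
      unfolding cluster_s_def last1[unfolded last] by (rule div_by_1)
    have s_eq: "cluster_s R K (Ns ! (k - 1)) = cluster_s R K (Ns ! k)" if "k \<ge> 1"
      unfolding s_last by (rule deg[OF that order_refl, symmetric])
    let ?Hs = "map (\<lambda>F. Aut R F E) Ns"
    have gc: "group_chain G H ?Hs" unfolding H by (rule group_chain_map_Aut[OF L c])
    have gc_unique: "Hs = ?Hs" if "group_chain G H Hs" for Hs
      by (rule iterate_chain_unique[OF group_chain_iterate[OF that] group_chain_iterate[OF gc]])
    have nth: "?Hs ! i = Aut R (Ns ! i) E" if "i \<le> k" for i using that len by simp
    have fixed: "Ns ! i = fixed_field E (?Hs ! i)" if "i \<le> k" for i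
      unfolding nth[OF that] using fixed_field_Aut[OF sub[OF that]] by simp
    have norm: "normal (?Hs ! (i - 1)) (G\<lparr>carrier := ?Hs ! i\<rparr>)" if i: "1 \<le> i" "i \<le> k" for i
    proof -
      have s: "sub_extension (Ns ! (i - 1))" using sub i by simp
      have 1: "?Hs ! i = normalizer G (Aut R (Ns ! (i - 1)) E)"
        unfolding nth[OF i(2)] step[OF i] by (rule descend_sub(3)[OF s])
      have i': "i - 1 \<le> k" using i by simp
      show ?thesis unfolding 1 nth[OF i'] by (rule G.subgroup_in_normalizer[OF Aut_subgroup[OF s]])
    qed
    have cards: "cluster_size R K (Ns ! i) * card (?Hs ! i) = card (?Hs ! Suc i) \<and>
                 cluster_s R K (Ns ! i) * card (?Hs ! Suc i) = card (carrier G)" if i: "i < k" for i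
    proof -
      have s: "sub_extension (Ns ! i)" using sub i by simp
      have i': "i \<le> k" "Suc i \<le> k" using i by simp_all
      have st: "Ns ! Suc i = descend (Ns ! i)" using step[OF _ i'(2)] by simp
      show ?thesis
        unfolding nth[OF i'(1)] nth[OF i'(2)] st using cluster_size_card[OF s] cluster_s_card[OF s] by (rule conjI)
    qed
    have last_sub: "last Ns \<subseteq> L"
    proof -
      have "Ns ! i \<subseteq> L" if "i \<le> k" for i
        using that
      proof (induct i)
        case 0 then show ?case using c unfolding iterate_chain_def by simp
      next
        case (Suc i)
        then show ?case using step[of "Suc i"] descend_sub(2)[OF sub[of i]] by auto
      qed
      then show ?thesis unfolding last by simp
    qed
    have weak: "weak_cluster_magnification R K (last Ns) L"
      unfolding weak_cluster_magnification_def last1 using last_sub sub[of k] last by simp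
    have factor: "magnification_factor R K (last Ns) L = cluster_size R K L"
      unfolding magnification_factor_def last1 by simp
    have galois_last: "last Ns = K \<longleftrightarrow> galois_ext R K (Ns ! (k - 1))" if "k \<ge> 1"
      unfolding last step[OF that order_refl] using descend_eq_base_iff(2)[OF sub[of "k - 1"]] by simp
    \<comment> \<open>Uniqueness turns each claim that the chain is a given short list into finitely
      many equations and inequations about \<open>descend\<close>.\<close>
    have chain_iff: "Ns = Ms \<longleftrightarrow> iterate_chain descend L Ms" for Ms
    proof
      show "iterate_chain descend L Ms" if "Ns = Ms" using c unfolding that .
      show "Ns = Ms" if "iterate_chain descend L Ms" using iterate_chain_unique[OF c that] .
    qed
    have five: "cluster_size R K L = 1 \<longleftrightarrow> normalizer G H = H" "normalizer G H = H \<longleftrightarrow> Ns = [L]"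
      unfolding H chain_iff iterate_chain_single using descend_eq_self_iff[OF L] by simp_all
    have six: "galois_ext R K L \<longleftrightarrow> normalizer G H = carrier G" "normalizer G H = carrier G \<longleftrightarrow> Ns = [L, K]"
    proof -
      show "galois_ext R K L \<longleftrightarrow> normalizer G H = carrier G"
        unfolding H using descend_eq_base_iff[OF L] by blast
      \<comment> \<open>Nontriviality of the extension enters here: it makes the step from
        \<open>L\<close> to \<open>K\<close> strict.\<close>
      have "Ns = [L, K] \<longleftrightarrow> descend L = K"
        unfolding chain_iff iterate_chain_two using LK[symmetric] descend_base by simp
      then show "normalizer G H = carrier G \<longleftrightarrow> Ns = [L, K]"
        unfolding H descend_eq_base_iff(1)[OF L] by (rule sym)
    qed
    \<comment> \<open>Normality of \<open>normalizer G H\<close> means that its own normalizer is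
      all of \<open>G\<close>, so a second application of \<open>descend\<close> reaches
      \<open>K\<close>; properness means that the first one did not.\<close>
    have seven: "normalizer G H \<noteq> carrier G \<and> normal (normalizer G H) G \<longleftrightarrow> Ns = [L, N, K]"
    proof -
      have "Ns = [L, N, K] \<longleftrightarrow> descend L \<noteq> L \<and> descend (descend L) = K \<and> K \<noteq> descend L"
        unfolding chain_iff iterate_chain_three N' using descend_base by simp
      also have "\<dots> \<longleftrightarrow> descend L \<noteq> K \<and> descend (descend L) = K"
      proof (intro iffI conjI; elim conjE)
        assume ne: "descend L \<noteq> K" and K: "descend (descend L) = K"
        show "descend L \<noteq> L"
        proof
          assume "descend L = L"
          then have "descend (descend L) = descend L" by (rule arg_cong)
          then have "descend L = K" unfolding K by (rule sym)
          then show False using ne by contradiction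
        qed
        show "descend (descend L) = K" by (rule K)
        show "K \<noteq> descend L" using ne by (rule not_sym)
      qed (auto dest: not_sym)
      also have "\<dots> \<longleftrightarrow> normalizer G H \<noteq> carrier G \<and> normal (normalizer G H) G"
        unfolding H D(3)[symmetric] G.normal_iff_normalizer[OF Aut_subgroup[OF D(1)] card_Aut(1)[OF D(1)]]
        unfolding descend_eq_base_iff(1)[OF D(1)] unfolding D(3) descend_eq_base_iff(1)[OF L] ..
      finally show ?thesis by (rule sym)
    qed
    have ex: "\<exists>!Hs. group_chain G H Hs" using gc gc_unique by blast
    have all: "\<forall>Hs. group_chain G H Hs \<longrightarrow> length Hs = length Ns \<and>
              (\<forall>i \<le> k. Ns ! i = fixed_field E (Hs ! i)) \<and>
              (\<forall>i. 1 \<le> i \<and> i \<le> k \<longrightarrow> normal (Hs ! (i - 1)) (G\<lparr>carrier := Hs ! i\<rparr>)) \<and>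
              (\<forall>i < k. cluster_size R K (Ns ! i) * card (Hs ! i) = card (Hs ! Suc i) \<and>
                       cluster_s R K (Ns ! i) * card (Hs ! Suc i) = card (carrier G))"
    proof (intro allI impI)
      fix Hs assume "group_chain G H Hs"
      then have Hs: "Hs = ?Hs" by (rule gc_unique)
      have "length ?Hs = length Ns" by simp
      moreover have "\<forall>i \<le> k. Ns ! i = fixed_field E (?Hs ! i)" using fixed by blast
      moreover have "\<forall>i. 1 \<le> i \<and> i \<le> k \<longrightarrow> normal (?Hs ! (i - 1)) (G\<lparr>carrier := ?Hs ! i\<rparr>)"
        using norm by blast
      moreover have "\<forall>i < k. cluster_size R K (Ns ! i) * card (?Hs ! i) = card (?Hs ! Suc i) \<and>
                       cluster_s R K (Ns ! i) * card (?Hs ! Suc i) = card (carrier G)"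
        using cards by blast
      ultimately show "length Hs = length Ns \<and>
              (\<forall>i \<le> k. Ns ! i = fixed_field E (Hs ! i)) \<and>
              (\<forall>i. 1 \<le> i \<and> i \<le> k \<longrightarrow> normal (Hs ! (i - 1)) (G\<lparr>carrier := Hs ! i\<rparr>)) \<and>
              (\<forall>i < k. cluster_size R K (Ns ! i) * card (Hs ! i) = card (Hs ! Suc i) \<and>
                       cluster_s R K (Ns ! i) * card (Hs ! Suc i) = card (carrier G))"
        unfolding Hs by (intro conjI)
    qed
    have deg': "\<forall>i. 1 \<le> i \<and> i \<le> k \<longrightarrow> ext_degree R K (Ns ! i) = cluster_s R K (Ns ! (i - 1))"
      using deg by blast
    show ?thesis
      by (intro conjI deg' impI[OF s_eq] ex all weak factor impI[OF galois_last] five six seven)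
  qed
  show ?thesis
    by (intro conjI[OF part1 conjI[OF part2]] allI impI, elim conjE) (rule part3)
qed

end

theorem theorem7p1:
  fixes R :: "'a ring" and K L :: "'a set"
  assumes Kbar: "algebraic_closure R K"
    and perfect: "perfect_subfield R K"
    and finite: "finite_ext R K L"
    and nontrivial: "L \<noteq> K"
  defines "Lt \<equiv> galois_closure R K L"
    and "G \<equiv> Gal R K (galois_closure R K L)"
    and "H \<equiv> Aut R L (galois_closure R K L)"
    and "N \<equiv> fixed_field (galois_closure R K L)
                 (normalizer (Gal R K (galois_closure R K L)) (Aut R L (galois_closure R K L)))"
  shows "(subfield N R \<and> K \<subseteq> N \<and> N \<subseteq> L \<and> galois_ext R N L \<and>
         ext_degree R N L = cluster_size R K L \<and>
         (\<forall>N'. subfield N' R \<and> K \<subseteq> N' \<and> N' \<subseteq> L \<and> galois_ext R N' L \<and>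
               ext_degree R N' L = cluster_size R K L \<longrightarrow> N' = N) \<and>
         ext_degree R K N = cluster_s R K L) \<and>
        (\<exists>!Ns. field_chain R K L Ns) \<and>
        (\<forall>Ns k. field_chain R K L Ns \<and> k = length Ns - 1 \<longrightarrow>
          (\<forall>i. 1 \<le> i \<and> i \<le> k \<longrightarrow> ext_degree R K (Ns ! i) = cluster_s R K (Ns ! (i - 1))) \<and>
          (k \<ge> 1 \<longrightarrow> cluster_s R K (Ns ! (k - 1)) = cluster_s R K (Ns ! k)) \<and>
          (\<exists>!Hs. group_chain G H Hs) \<and>
          (\<forall>Hs. group_chain G H Hs \<longrightarrow>
              length Hs = length Ns \<and>
              (\<forall>i \<le> k. Ns ! i = fixed_field Lt (Hs ! i)) \<and>
              (\<forall>i. 1 \<le> i \<and> i \<le> k \<longrightarrow> normal (Hs ! (i - 1)) (G\<lparr>carrier := Hs ! i\<rparr>)) \<and>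
              (\<forall>i < k. cluster_size R K (Ns ! i) * card (Hs ! i) = card (Hs ! Suc i) \<and>
                       cluster_s R K (Ns ! i) * card (Hs ! Suc i) = card (carrier G))) \<and>
          weak_cluster_magnification R K (last Ns) L \<and>
          magnification_factor R K (last Ns) L = cluster_size R K L \<and>
          (k \<ge> 1 \<longrightarrow> (last Ns = K \<longleftrightarrow> galois_ext R K (Ns ! (k - 1)))) \<and>
          (cluster_size R K L = 1 \<longleftrightarrow> normalizer G H = H) \<and>
          (normalizer G H = H \<longleftrightarrow> Ns = [L]) \<and>
          (galois_ext R K L \<longleftrightarrow> normalizer G H = carrier G) \<and>
          (normalizer G H = carrier G \<longleftrightarrow> Ns = [L, K]) \<and>
          (normalizer G H \<noteq> carrier G \<and> normal (normalizer G H) G \<longleftrightarrow> Ns = [L, N, K]))"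
proof -
  interpret P: perfect_closure R K
    using Kbar perfect unfolding perfect_closure_def perfect_closure_axioms_def by blast
  obtain \<theta> where "galois_setting R K Lt \<theta>"
    using P.galois_setting_closure(1)[OF finite] unfolding Lt_def by blast
  then interpret S: galois_setting R K Lt \<theta> .
  have L: "S.sub_extension L"
    using finite P.galois_setting_closure(2)[OF finite] unfolding finite_ext_def Lt_def by blast
  have G: "G = Gal R K Lt" unfolding G_def Lt_def ..
  have H: "H = Aut R L Lt" unfolding H_def Lt_def ..
  have N: "N = fixed_field Lt (normalizer (Gal R K Lt) (Aut R L Lt))" unfolding N_def Lt_def ..
  show ?thesis unfolding G by (rule S.normalizer_chain[OF L nontrivial H N])
qed

end
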